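(* Let $\mu$ be a non-degenerate probability measure on $\Gamma=\mathbb Z_2*\mathbb Z_3$ whose support is contained in $S=\{a,b,\bar b,ba,\bar b a\}$, with weights $$\mu(a)=\mathfrak a,\quad \mu(b)=\mathfrak b,\quad \mu(\bar b)=\bar{\mathfrak b},\quad \mu(ba)=\mathfrak b',\quad \mu(\bar b a)=\bar{\mathfrak b}'.$$ Let $0<\alpha<1$. The harmonic measure $\nu$ of the random walk $(\Gamma,\mu)$ belongs to the Denjoy class $\boldsymbol\kappa^\alpha$ if and only if $$\bigl[\alpha-\bar{\mathfrak b}(1-\alpha)-\mathfrak b'\bigr]\cdot\bigl[\mathfrak a(1-\alpha)+\mathfrak b'\alpha+\bar{\mathfrak b}\bigr]=\bigl[\mathfrak a\,\alpha+\bar{\mathfrak b}'(1-\alpha)+\mathfrak b\bigr]\cdot\bigl[(1-\alpha)-\mathfrak b\,\alpha-\bar{\mathfrak b}'\bigr].$$ In particular, $\nu$ belongs to the Minkowski class $\boldsymbol\kappa^{1/2}$ if and only if $$\bigl(1-\bar{\mathfrak b}-2\mathfrak b'\bigr)\bigl(\mathfrak a+\mathfrak b'+2\bar{\mathfrak b}\bigr)=\bigl(\mathfrak a+\bar{\mathfrak b}'+2\mathfrak b\bigr)\bigl(1-\mathfrak b-2\bar{\mathfrak b}'\bigr).$$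
   Context: $\Gamma=\mathbb Z_2*\mathbb Z_3$ with $\mathbb Z_2=\langle a\mid a^2\rangle$, $\mathbb Z_3=\langle b\mid b^3\rangle$, $\bar b=b^{-1}=b^2$. Elements of $\Gamma$ are identified with finite words in $\{a,b,\bar b\}$ in which the letter $a$ and letters from $\{b,\bar b\}$ alternate. $\partial\Gamma$ is the set of right-infinite words in $\{a,b,\bar b\}$ subject to the same alternation rule, with the topology induced by the product topology; $\Gamma$ acts on it on the left by concatenation followed, if necessary, by reduction. A sequence $g_n\in\Gamma$ converges to $\gamma\in\partial\Gamma$ if for every $k$ the first $k$ letters of $g_n$ coincide with those of $\gamma$ for all large $n$. A probability measure $\mu$ on $\Gamma$ is non-degenerate if its support generates $\Gamma$ as a semigroup. For $\mu$ as in the claim, the sample paths $g_n=h_1\cdots h_n$ (with $h_i$ independent and $\mu$-distributed) of the random walk $(\Gamma,\mu)$ converge almost surely to $\partial\Gamma$; the distribution of the limit is the harmonic measure of $\mu$; it is the unique probability measure $\nu$ on $\partial\Gamma$ with $\nu=\sum_g\mu(g)\,g\nu$. For $0<\alpha<1$ let $\kappa^\alpha$ be the distribution of the random infinite word $a\beta_1a\beta_2a\cdots$, where the $\beta_i$ are independent and take the values $b$ and $\bar b$ with probabilities $\alpha$ and $1-\alpha$. For $0<p<1$ put $\kappa^{\alpha,p}=p\,\kappa^\alpha+(1-p)\,a\kappa^\alpha$, where $a\kappa^\alpha$ is the image of $\kappa^\alpha$ under the action of $a$ (the distribution of $\beta_1a\beta_2a\cdots$). The Denjoy measure class $\boldsymbol\kappa^\alpha$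 is the common measure class of the measures $\kappa^{\alpha,p}$, $0<p<1$; for $\alpha=\frac12$ it is called the Minkowski class. *)

theory Defs
  imports "HOL-Probability.Probability" "HOL-Algebra.Group"
begin

section \<open>The group \<open>\<Gamma> = \<int>\<^sub>2 * \<int>\<^sub>3\<close> as reduced words\<close>

text \<open>The letters \<open>a\<close>, \<open>b\<close> and \<open>b\<^sup>-\<^sup>1\<close>.\<close>

datatype letter = La | Lb | Lbi

definition alternating :: "letter list \<Rightarrow> bool" where
  "alternating w \<longleftrightarrow> (\<forall>i. Suc i < length w \<longrightarrow> (w ! i = La) \<noteq> (w ! Suc i = La))"

text \<open>The reduced word representing the product of two letters, using
  \<open>a\<^sup>2 = 1\<close>, \<open>b\<^sup>3 = 1\<close>. A cancellation or a merge never propagates further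
  into an alternating word, so this is all the reduction that is needed when a letter is
  multiplied from the left onto an alternating (finite or infinite) word.\<close>

fun letter_pair :: "letter \<Rightarrow> letter \<Rightarrow> letter list" where
  "letter_pair La La = []"
| "letter_pair Lb Lb = [Lbi]"
| "letter_pair Lbi Lbi = [Lb]"
| "letter_pair Lb Lbi = []"
| "letter_pair Lbi Lb = []"
| "letter_pair x y = [x, y]"

fun push :: "letter \<Rightarrow> letter list \<Rightarrow> letter list" where
  "push x [] = [x]"
| "push x (y # w) = letter_pair x y @ w"

definition Gamma :: "letter list monoid" where
  "Gamma = \<lparr>carrier = {w. alternating w}, mult = (\<lambda>u v. foldr push u v), one = []\<rparr>"

inductive_set semigroup_span :: "('a, 'b) monoid_scheme \<Rightarrow> 'a set \<Rightarrow> 'a set"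
  for G :: "('a, 'b) monoid_scheme" and X :: "'a set" where
  incl: "x \<in> X \<Longrightarrow> x \<in> semigroup_span G X"
| mult: "x \<in> semigroup_span G X \<Longrightarrow> y \<in> semigroup_span G X \<Longrightarrow> x \<otimes>\<^bsub>G\<^esub> y \<in> semigroup_span G X"

definition nondegenerate :: "letter list pmf \<Rightarrow> bool" where
  "nondegenerate \<mu> \<longleftrightarrow> semigroup_span Gamma (set_pmf \<mu>) = carrier Gamma"


section \<open>The boundary\<close>

definition boundary :: "letter stream set" where
  "boundary = {w. \<forall>i. (w !! i = La) \<noteq> (w !! Suc i = La)}"

text \<open>The alphabet is finite and discrete, so the product \<open>\<sigma>\<close>-algebra used here is the
  Borel \<open>\<sigma>\<close>-algebra of the topology induced by the product topology.\<close>

definition boundary_space :: "letter stream measure" where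
  "boundary_space = restrict_space (stream_space (count_space UNIV)) boundary"

definition push_stream :: "letter \<Rightarrow> letter stream \<Rightarrow> letter stream" where
  "push_stream x w = letter_pair x (shd w) @- stl w"

definition act :: "letter list \<Rightarrow> letter stream \<Rightarrow> letter stream" where
  "act g w = foldr push_stream g w"

definition converges_to :: "(nat \<Rightarrow> letter list) \<Rightarrow> letter stream \<Rightarrow> bool" where
  "converges_to g \<gamma> \<longleftrightarrow> (\<forall>k. eventually (\<lambda>n. take k (g n) = stake k \<gamma>) sequentially)"


section \<open>The random walk and its harmonic measure\<close>

text \<open>For a stream \<open>\<omega> = (h\<^sub>1, h\<^sub>2, \<dots>)\<close> of increments, this is \<open>g\<^sub>n = h\<^sub>1 \<cdots> h\<^sub>n\<close>.\<close>

definition walk :: "letter list stream \<Rightarrow> nat \<Rightarrow> letter list" where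
  "walk \<omega> n = foldr (mult Gamma) (stake n \<omega>) \<one>\<^bsub>Gamma\<^esub>"

text \<open>Paths that do not converge to the boundary (almost surely there are none for the random
  walks of interest) are sent to an arbitrary boundary point, to make the map total.\<close>

definition limit_point :: "letter list stream \<Rightarrow> letter stream" where
  "limit_point \<omega> =
     (if \<exists>\<gamma>\<in>boundary. converges_to (walk \<omega>) \<gamma>
      then THE \<gamma>. \<gamma> \<in> boundary \<and> converges_to (walk \<omega>) \<gamma>
      else cycle [La, Lb])"

definition harmonic_measure :: "letter list pmf \<Rightarrow> letter stream measure" where
  "harmonic_measure \<mu> = distr (stream_space (measure_pmf \<mu>)) boundary_space limit_point"


section \<open>The Denjoy measure classes\<close>

text \<open>The word \<open>a \<beta>\<^sub>1 a \<beta>\<^sub>2 a \<cdots>\<close>, where \<open>True\<close> codes \<open>b\<close> and \<open>False\<close> codes \<open>b\<^sup>-\<^sup>1\<close>.\<close>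

definition coin_word :: "bool stream \<Rightarrow> letter stream" where
  "coin_word \<beta> = sinterleave (sconst La) (smap (\<lambda>x. if x then Lb else Lbi) \<beta>)"

definition kappa :: "real \<Rightarrow> letter stream measure" where
  "kappa \<alpha> = distr (stream_space (measure_pmf (bernoulli_pmf \<alpha>))) boundary_space coin_word"

definition kappa_mix :: "real \<Rightarrow> real \<Rightarrow> letter stream measure" where
  "kappa_mix \<alpha> p =
     measure_of (space boundary_space) (sets boundary_space)
       (\<lambda>X. ennreal p * emeasure (kappa \<alpha>) X
          + ennreal (1 - p) * emeasure (distr (kappa \<alpha>) boundary_space (act [La])) X)"

definition equivalent_measures :: "'a measure \<Rightarrow> 'a measure \<Rightarrow> bool" where
  "equivalent_measures M N \<longleftrightarrow>
     sets M = sets N \<and> absolutely_continuous M N \<and> absolutely_continuous N M"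

text \<open>For \<open>0 < p < 1\<close> the measures \<open>kappa_mix \<alpha> p\<close> are pairwise equivalent, so quantifying
  over all \<open>p\<close> gives their common class.\<close>

definition denjoy_class :: "real \<Rightarrow> letter stream measure set" where
  "denjoy_class \<alpha> = {\<nu>. \<forall>p. 0 < p \<and> p < 1 \<longrightarrow> equivalent_measures \<nu> (kappa_mix \<alpha> p)}"

definition minkowski_class :: "letter stream measure set" where
  "minkowski_class = denjoy_class (1 / 2)"

end

theory Submission
  imports Defs
begin

text \<open>
  The measure \<open>\<nu> = p \<kappa>\<^sup>\<theta> + (1 - p) a\<kappa>\<^sup>\<theta>\<close> is a combination of \<open>\<kappa>\<^sup>\<theta>\<close>, \<open>b\<kappa>\<^sup>\<theta>\<close> and \<open>b\<^sup>-\<^sup>1\<kappa>\<^sup>\<theta>\<close>,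
  and so are all its translates by the five possible increments. Comparing coefficients, \<open>\<nu>\<close> is
  \<open>\<mu>\<close>-stationary iff \<open>p\<close> solves two linear equations; these are compatible iff \<open>\<theta>\<close> is a
  root of the equation of the theorem, and non-degeneracy then puts \<open>p\<close> in \<open>(0, 1)\<close>.
  The equation changes sign between 0 and 1, so it always has a root \<open>\<theta>\<close>. A stationary
  measure of this form is the harmonic measure, and measures belonging to different parameters
  are mutually singular, so the harmonic measure lies in the class of \<open>\<alpha>\<close> iff \<open>\<alpha>\<close> is a root.

  That a stationary \<open>\<nu>\<close> is the limit law is seen as follows. The functions \<open>g \<mapsto> (g\<nu>)(X)\<close> are
  bounded and harmonic, so their expected energy along the walk is finite; since \<open>\<nu>\<close> is not
  invariant, this makes the walk transient, and with bounded increments transience forces the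
  prefixes to stabilize. For a long word \<open>g\<close>, the measure \<open>g\<nu>\<close> is concentrated near \<open>g\<close>, so the
  probability of a prefix converges to its \<open>\<nu>\<close>-measure.
\<close>

section \<open>Words and their action\<close>

instance letter :: finite
proof
  have "x \<in> {La, Lb, Lbi}" for x
    by (cases x) simp_all
  then show "finite (UNIV :: letter set)"
    by (intro finite_subset [of UNIV "{La, Lb, Lbi}"]) auto
qed

fun linv :: "letter \<Rightarrow> letter" where
  "linv La = La"
| "linv Lb = Lbi"
| "linv Lbi = Lb"

definition winv :: "letter list \<Rightarrow> letter list" where
  "winv w = rev (map linv w)"

abbreviation gmult :: "letter list \<Rightarrow> letter list \<Rightarrow> letter list" (infixl "\<cdot>" 70) where
  "u \<cdot> v \<equiv> foldr push u v"

lemma mult_Gamma [simp]: "mult Gamma = (\<cdot>)"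
  by (simp add: Gamma_def fun_eq_iff)

lemma one_Gamma [simp]: "\<one>\<^bsub>Gamma\<^esub> = []"
  by (simp add: Gamma_def)

lemma carrier_Gamma: "w \<in> carrier Gamma \<longleftrightarrow> alternating w"
  by (simp add: Gamma_def)

lemma alternating_Nil [simp]: "alternating []"
  by (simp add: alternating_def)

lemma alternating_Cons:
  "alternating (x # w) \<longleftrightarrow> (w = [] \<or> (x = La) \<noteq> (hd w = La)) \<and> alternating w"
proof (cases w)
  case Nil
  then show ?thesis by (simp add: alternating_def)
next
  case (Cons y v)
  have "(\<forall>i. Suc i < length (x # w) \<longrightarrow> ((x # w) ! i = La) \<noteq> ((x # w) ! Suc i = La))
     \<longleftrightarrow> ((x # w) ! 0 = La) \<noteq> ((x # w) ! Suc 0 = La) \<and>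
        (\<forall>i. Suc (Suc i) < length (x # w) \<longrightarrow> ((x # w) ! Suc i = La) \<noteq> ((x # w) ! Suc (Suc i) = La))"
    using Cons by (auto simp del: nth_Cons_Suc) (metis One_nat_def Suc_less_eq not0_implies_Suc zero_less_Suc nth_Cons_Suc nth_Cons_0)+
  then show ?thesis
    using Cons by (simp add: alternating_def)
qed

lemma alternating_singleton [simp]: "alternating [x]"
  by (simp add: alternating_Cons)

lemma alternating_Cons2 [simp]:
  "alternating (x # y # w) \<longleftrightarrow> (x = La) \<noteq> (y = La) \<and> alternating (y # w)"
  by (simp add: alternating_Cons [of x])

lemma alternating_append:
  "alternating (u @ v) \<longleftrightarrow>
     alternating u \<and> alternating v \<and> (u = [] \<or> v = [] \<or> (last u = La) \<noteq> (hd v = La))"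
  by (induction u) (auto simp: alternating_Cons)

lemma alternating_push: "alternating w \<Longrightarrow> alternating (push x w)"
  by (cases w; cases x; cases "hd w") (auto simp: alternating_Cons)

lemma alternating_mult: "alternating w \<Longrightarrow> alternating (u \<cdot> w)"
  by (induction u) (auto intro: alternating_push)

text \<open>The one case check behind associativity: \<open>y\<close> may cancel the first letter of
  \<open>w\<close>, and \<open>x\<close> then meets the second, but by alternation the reduction
  goes no further.\<close>

lemma push_push:
  assumes "alternating w"
  shows "push x (push y w) = letter_pair x y \<cdot> w"
proof (cases w)
  case Nil
  then show ?thesis by (cases x; cases y) simp_all
next
  case (Cons z v)
  with assms show ?thesis
    by (cases v; cases x; cases y; cases z; cases "hd v") auto
qed

lemma push_mult: "alternating w \<Longrightarrow> push x v \<cdot> w = push x (v \<cdot> w)"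
  by (cases v) (simp_all add: push_push alternating_mult)

lemma mult_assoc: "alternating w \<Longrightarrow> (u \<cdot> v) \<cdot> w = u \<cdot> (v \<cdot> w)"
  by (induction u) (simp_all add: push_mult)

lemma push_alternating [simp]:
  "alternating (x # w) \<Longrightarrow> push x w = x # w"
  by (cases w; cases x; cases "hd w") (auto simp: alternating_Cons)

lemma mult_eq_append: "alternating (u @ v) \<Longrightarrow> u \<cdot> v = u @ v"
proof (induction u)
  case (Cons x u)
  then have "alternating (u @ v)" "alternating (x # u @ v)"
    by (auto simp: alternating_Cons [of x])
  with Cons.IH show ?case
    by simp
qed simp

lemma mult_Nil_right: "alternating u \<Longrightarrow> u \<cdot> [] = u"
  using mult_eq_append [of u "[]"] by simp

lemma winv_mult: "winv g \<cdot> g = []"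
proof (induction g)
  case (Cons x g)
  have "push (linv x) (x # g) = g"
    by (cases x) simp_all
  with Cons show ?case
    by (simp add: winv_def)
qed (simp add: winv_def)

lemma linv_eq_La [simp]: "linv x = La \<longleftrightarrow> x = La"
  by (cases x) simp_all

lemma length_winv [simp]: "length (winv w) = length w"
  by (simp add: winv_def)

text \<open>Two adjacent letters of the same type (\<open>La\<close>, or one of \<open>Lb\<close>
  and \<open>Lbi\<close>) either merge within that type or both vanish. If the product no longer
  begins with the type of \<open>y1\<close>, all of \<open>y1 # y\<close> has vanished, so
  \<open>h\<close> begins with the inverse letters.\<close>

lemma mult_full_cancel:
  assumes "alternating (y1 # y)" and "alternating h"
    and "(y1 # y) \<cdot> h = [] \<or> (hd ((y1 # y) \<cdot> h) = La) \<noteq> (y1 = La)"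
  shows "h = winv (y1 # y) @ (y1 # y) \<cdot> h"
  using assms
proof (induction y arbitrary: y1)
  case Nil
  then show ?case
    by (cases h; cases y1; cases "hd h"; cases "tl h") (auto simp: winv_def)
next
  case (Cons y2 y)
  let ?z = "(y2 # y) \<cdot> h"
  have alt: "alternating ?z"
    using Cons.prems(2) by (rule alternating_mult)
  have *: "push y1 ?z = [] \<or> (hd (push y1 ?z) = La) \<noteq> (y1 = La)"
    using Cons.prems(3) by simp
  \<comment> \<open>\<open>y1\<close> can only have vanished against its inverse. So
    \<open>?z\<close> begins with the type of \<open>y1\<close>, not with that of \<open>y2\<close>,
    and the induction hypothesis applies.\<close>
  then have z: "?z = linv y1 # push y1 ?z"
    using alt
    by (cases ?z; cases y1; cases "hd ?z"; cases "tl ?z") (auto simp del: foldr.simps)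
  have "h = winv (y2 # y) @ ?z"
  proof (rule Cons.IH)
    show "?z = [] \<or> (hd ?z = La) \<noteq> (y2 = La)"
      using z Cons.prems(1) by (metis alternating_Cons2 linv_eq_La list.sel(1))
  qed (use Cons.prems in simp_all)
  with z have "h = winv (y2 # y) @ linv y1 # push y1 ?z"
    by simp
  then show ?case
    by (simp add: winv_def)
qed

text \<open>A change within the first \<open>k\<close> letters would require \<open>h\<close> to
  cancel the whole suffix \<open>drop k g\<close>, and \<open>h\<close> is too short for
  that.\<close>

lemma take_mult:
  assumes "alternating g" "alternating h" "k + length h < length g"
  shows "take k (g \<cdot> h) = take k g"
proof -
  define x y where "x = take k g" and "y = drop k g"
  have g: "g = x @ y" and x: "length x = k" and y: "length h < length y"
    using assms by (auto simp: x_def y_def)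
  then obtain y1 y' where y1: "y = y1 # y'"
    by (cases y) auto
  have alt: "alternating x" "alternating y" "x = [] \<or> (last x = La) \<noteq> (y1 = La)"
    using assms(1) y1 unfolding g alternating_append by auto
  have "y \<cdot> h \<noteq> [] \<and> (hd (y \<cdot> h) = La) = (y1 = La)"
  proof (rule ccontr)
    assume "\<not> ?thesis"
    then have "h = winv y @ y \<cdot> h"
      using mult_full_cancel [of y1 y' h] alt assms y1 by blast
    then have "length y \<le> length h"
      by (metis length_append length_winv le_add1)
    with y show False by simp
  qed
  then have "alternating (x @ y \<cdot> h)"
    using alt assms(2) by (auto simp: alternating_append alternating_mult)
  then have "g \<cdot> h = x @ y \<cdot> h"
    using mult_eq_append g by simp
  then show ?thesis
    by (simp add: x x_def [symmetric])
qed

section \<open>The action on infinite words\<close>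

lemma boundary_iff: "w \<in> boundary \<longleftrightarrow> (\<forall>i. (w !! i = La) \<noteq> (w !! Suc i = La))"
  by (simp add: boundary_def)

lemma boundary_SCons:
  "x ## w \<in> boundary \<longleftrightarrow> (x = La) \<noteq> (shd w = La) \<and> w \<in> boundary"
proof -
  have "(\<forall>i. ((x ## w) !! i = La) \<noteq> ((x ## w) !! Suc i = La)) \<longleftrightarrow>
     ((x ## w) !! 0 = La) \<noteq> ((x ## w) !! Suc 0 = La) \<and>
     (\<forall>i. ((x ## w) !! Suc i = La) \<noteq> ((x ## w) !! Suc (Suc i) = La))"
    by (metis not0_implies_Suc)
  then show ?thesis
    by (simp add: boundary_def)
qed

lemma act_Nil [simp]: "act [] w = w"
  and act_Cons [simp]: "act (x # g) w = push_stream x (act g w)"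
  and act_append: "act (u @ v) w = act u (act v w)"
  by (simp_all add: act_def)

lemma push_stream_boundary: "w \<in> boundary \<Longrightarrow> push_stream x w \<in> boundary"
  by (cases w; cases x; cases "shd w")
    (auto simp: push_stream_def boundary_SCons)

lemma act_boundary: "w \<in> boundary \<Longrightarrow> act g w \<in> boundary"
  by (induction g) (auto intro: push_stream_boundary)

lemma push_stream_push_stream:
  assumes "w \<in> boundary"
  shows "push_stream x (push_stream y w) = act (letter_pair x y) w"
proof -
  obtain z v where w: "w = z ## v" by (cases w)
  then show ?thesis
    using assms
    by (cases v; cases x; cases y; cases z; cases "shd v")
      (auto simp: push_stream_def boundary_SCons)
qed

lemma act_push: "w \<in> boundary \<Longrightarrow> act (push x v) w = push_stream x (act v w)"
  by (cases v) (simp_all add: push_stream_push_stream act_boundary act_append)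

lemma act_mult: "w \<in> boundary \<Longrightarrow> act (u \<cdot> v) w = act u (act v w)"
  by (induction u) (simp_all add: act_push)

lemma push_stream_eq_SCons [simp]:
  "(x = La) \<noteq> (shd w = La) \<Longrightarrow> push_stream x w = x ## w"
  by (cases w; cases x; cases "shd w") (auto simp: push_stream_def)

lemma act_eq_append:
  assumes "alternating u" and "u = [] \<or> (last u = La) \<noteq> (shd w = La)"
  shows "act u w = u @- w"
  using assms
proof (induction u)
  case (Cons x u)
  then show ?case
    by (cases u) auto
qed simp

lemma act_full_cancel:
  assumes "alternating (y1 # y)" and "w \<in> boundary"
    and "(shd (act (y1 # y) w) = La) \<noteq> (y1 = La)"
  shows "w = winv (y1 # y) @- act (y1 # y) w"
  using assms
proof (induction y arbitrary: y1)
  case Nil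
  then show ?case
    by (cases w; cases y1; cases "shd w"; cases "shd (stl w)")
      (auto simp: winv_def push_stream_def boundary_SCons)
next
  case (Cons y2 y)
  let ?z = "act (y2 # y) w"
  have bd: "?z \<in> boundary"
    using Cons.prems(2) by (rule act_boundary)
  have *: "(shd (push_stream y1 ?z) = La) \<noteq> (y1 = La)"
    using Cons.prems(3) by simp
  then have z: "?z = linv y1 ## push_stream y1 ?z"
    using bd
    by (cases ?z; cases y1; cases "shd ?z"; cases "shd (stl ?z)")
      (auto simp: push_stream_def boundary_SCons simp del: act_Cons)
  have "w = winv (y2 # y) @- ?z"
  proof (rule Cons.IH)
    show "(shd ?z = La) \<noteq> (y2 = La)"
      using z Cons.prems(1) by (metis alternating_Cons2 linv_eq_La stream.sel(1))
  qed (use Cons.prems in simp_all)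
  with z have "w = winv (y2 # y) @- linv y1 ## push_stream y1 ?z"
    by simp
  then show ?case
    by (simp add: winv_def)
qed

text \<open>As for finite words, altering the first \<open>k\<close> letters takes the cancellation
  of the whole rest of \<open>g\<close>. The exceptional boundary points thus lie in a single
  cylinder, which is deep when \<open>g\<close> is long.\<close>

lemma stake_act:
  assumes "alternating g" "w \<in> boundary" "k < length g"
    and "stake k (act g w) \<noteq> take k g"
  shows "stake (length g - k) w = winv (drop k g)"
proof -
  define x y where "x = take k g" and "y = drop k g"
  have g: "g = x @ y" and x: "length x = k" and y: "length y = length g - k"
    using assms by (auto simp: x_def y_def)
  then obtain y1 y' where y1: "y = y1 # y'"
    using assms(3) by (cases y) auto
  have alt: "alternating x" "alternating y" "x = [] \<or> (last x = La) \<noteq> (y1 = La)"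
    using assms(1) y1 unfolding g alternating_append by auto
  have "(shd (act y w) = La) \<noteq> (y1 = La)"
  proof (rule ccontr)
    assume "\<not> ?thesis"
    then have "act g w = x @- act y w"
      unfolding g act_append using alt by (intro act_eq_append) auto
    then show False
      using assms(4) x by (simp add: stake_shift g)
  qed
  then have "w = winv y @- act y w"
    using act_full_cancel alt assms(2) y1 by blast
  then have "stake (length y) w = winv y"
    by (metis append_Nil2 diff_self_eq_0 length_winv stake.simps(1) stake_shift take_all_iff order_refl)
  then show ?thesis
    by (simp add: y y_def)
qed

section \<open>The measures \<open>kappa_mix\<close>\<close>

lemma space_boundary_space [simp]: "space boundary_space = boundary"
  by (simp add: boundary_space_def space_restrict_space space_stream_space)

lemma measurable_boundary_spaceI:
  assumes "f \<in> N \<rightarrow>\<^sub>M stream_space (count_space UNIV)"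
    and "\<And>x. x \<in> space N \<Longrightarrow> f x \<in> boundary"
  shows "f \<in> N \<rightarrow>\<^sub>M boundary_space"
  unfolding boundary_space_def using assms
  by (intro measurable_restrict_space2) auto

lemma measurable_from_boundary_space:
  "f \<in> stream_space (count_space UNIV) \<rightarrow>\<^sub>M N \<Longrightarrow> f \<in> boundary_space \<rightarrow>\<^sub>M N"
  unfolding boundary_space_def by (rule measurable_restrict_space1)

lemma measurable_shift_const:
  "f \<in> N \<rightarrow>\<^sub>M stream_space (count_space UNIV) \<Longrightarrow>
    (\<lambda>x. xs @- f x) \<in> N \<rightarrow>\<^sub>M stream_space (count_space UNIV)"
  by (induction xs) simp_all

lemma measurable_push_stream:
  "push_stream x \<in> stream_space (count_space UNIV) \<rightarrow>\<^sub>M stream_space (count_space UNIV)"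
proof -
  have "(\<lambda>w. letter_pair x (shd w) @- stl w) \<in>
    stream_space (count_space UNIV) \<rightarrow>\<^sub>M stream_space (count_space UNIV)"
    by (rule measurable_compose_countable [where f = "\<lambda>l w. letter_pair x l @- stl w"])
      (auto intro: measurable_shift_const)
  then show ?thesis
    by (simp add: push_stream_def [abs_def])
qed

lemma measurable_act [measurable]: "act g \<in> boundary_space \<rightarrow>\<^sub>M boundary_space"
proof -
  have "act g \<in> stream_space (count_space UNIV) \<rightarrow>\<^sub>M stream_space (count_space UNIV)"
  proof (induction g)
    case Nil
    then show ?case by (simp add: act_def [abs_def])
  next
    case (Cons x g)
    then show ?case
      using measurable_compose [OF Cons measurable_push_stream [of x]]
      by (simp add: act_def [abs_def] comp_def)
  qed
  then show ?thesis
    by (intro measurable_boundary_spaceI measurable_from_boundary_space) (auto intro: act_boundary)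
qed

abbreviation coin :: "real \<Rightarrow> bool stream measure" where
  "coin \<alpha> \<equiv> stream_space (measure_pmf (bernoulli_pmf \<alpha>))"

lemma prob_space_coin: "prob_space (coin \<alpha>)"
  by (rule prob_space.prob_space_stream_space [OF prob_space_measure_pmf])

lemma space_coin [simp]: "space (coin \<alpha>) = UNIV"
  by (simp add: space_stream_space)

lemma coin_word_SCons:
  "coin_word (x ## \<beta>) = La ## (if x then Lb else Lbi) ## coin_word \<beta>"
  by (simp add: coin_word_def stream_eq_Stream_iff)

lemma shd_coin_word [simp]: "shd (coin_word \<beta>) = La"
  by (simp add: coin_word_def)

lemma coin_word_snth:
  "coin_word \<beta> !! n = (if even n then La else if \<beta> !! (n div 2) then Lb else Lbi)"
  by (simp add: coin_word_def)

lemma coin_word_boundary: "coin_word \<beta> \<in> boundary"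
  by (simp add: boundary_iff coin_word_snth del: snth.simps)

lemma measurable_coin_word [measurable]: "coin_word \<in> coin \<alpha> \<rightarrow>\<^sub>M boundary_space"
proof (rule measurable_boundary_spaceI)
  show "coin_word \<in> coin \<alpha> \<rightarrow>\<^sub>M stream_space (count_space UNIV)"
    by (rule measurable_stream_space2) (simp add: coin_word_snth)
qed (rule coin_word_boundary)

text \<open>Conditioning on the first toss.\<close>

lemma measure_coin_rec:
  assumes [measurable]: "X \<in> sets (coin \<alpha>)" and "0 < \<alpha>" "\<alpha> < 1"
  shows "measure (coin \<alpha>) X =
    \<alpha> * measure (coin \<alpha>) {\<beta>. True ## \<beta> \<in> X} + (1 - \<alpha>) * measure (coin \<alpha>) {\<beta>. False ## \<beta> \<in> X}"
proof -
  interpret prob_space "coin \<alpha>" by (rule prob_space_coin)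
  have "ennreal (measure (coin \<alpha>) X) =
    ennreal (measure (coin \<alpha>) {\<beta>. True ## \<beta> \<in> X}) * ennreal \<alpha> +
    ennreal (measure (coin \<alpha>) {\<beta>. False ## \<beta> \<in> X}) * ennreal (1 - \<alpha>)"
    using prob_space.emeasure_stream_space [OF prob_space_measure_pmf assms(1)] assms(2,3)
    by (simp add: emeasure_eq_measure)
  also have "\<dots> = ennreal (\<alpha> * measure (coin \<alpha>) {\<beta>. True ## \<beta> \<in> X}
      + (1 - \<alpha>) * measure (coin \<alpha>) {\<beta>. False ## \<beta> \<in> X})"
    using assms(2,3) by (simp add: ennreal_mult ennreal_plus mult.commute)
  finally show ?thesis
    using assms(2,3) by (subst (asm) ennreal_inj) auto
qed

text \<open>The mass of \<open>X\<close> under the translate of \<open>kappa \<alpha>\<close> by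
  \<open>g\<close>. Unreduced words are allowed, so translates compose by concatenation and are
  simplified with \<open>kact_reduce\<close>.\<close>

definition kact :: "real \<Rightarrow> letter stream set \<Rightarrow> letter list \<Rightarrow> real" where
  "kact \<alpha> X g = measure (coin \<alpha>) {\<beta>. act g (coin_word \<beta>) \<in> X}"

lemma sets_coin_act:
  assumes [measurable]: "X \<in> sets boundary_space"
  shows "{\<beta>. act g (coin_word \<beta>) \<in> X} \<in> sets (coin \<alpha>)"
proof -
  have "{\<beta> \<in> space (coin \<alpha>). act g (coin_word \<beta>) \<in> X} \<in> sets (coin \<alpha>)"
    by measurable
  then show ?thesis by simp
qed

lemma kact_cong:
  "(\<And>w. w \<in> boundary \<Longrightarrow> act g w = act h w) \<Longrightarrow> kact \<alpha> X g = kact \<alpha> X h"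
  by (simp add: kact_def coin_word_boundary)

lemma kact_reduce:
  "kact \<alpha> X (u @ x # y # v) = kact \<alpha> X (u @ letter_pair x y @ v)"
  by (rule kact_cong) (simp add: act_append act_boundary push_stream_push_stream)

text \<open>Self-similarity of \<open>kappa \<alpha>\<close>: behind the leading \<open>La\<close>
  and the first toss, a coin word continues as a coin word with the same law.\<close>

lemma kact_split:
  assumes "X \<in> sets boundary_space" "0 < \<alpha>" "\<alpha> < 1"
  shows "kact \<alpha> X g = \<alpha> * kact \<alpha> X (g @ [La, Lb]) + (1 - \<alpha>) * kact \<alpha> X (g @ [La, Lbi])"
  unfolding kact_def
  by (subst measure_coin_rec) (use assms in \<open>auto simp: sets_coin_act coin_word_SCons act_append\<close>)

lemma emeasure_kappa_mix:
  assumes "X \<in> sets boundary_space"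
  shows "emeasure (kappa_mix \<alpha> p) X =
    ennreal p * emeasure (kappa \<alpha>) X
    + ennreal (1 - p) * emeasure (distr (kappa \<alpha>) boundary_space (act [La])) X"
    (is "_ = ?f X")
proof (rule emeasure_measure_of)
  let ?D = "distr (kappa \<alpha>) boundary_space (act [La])"
  have s: "sets (kappa_mix \<alpha> p) = sets boundary_space"
    unfolding kappa_mix_def by (rule sets.sets_measure_of_eq)
  show "kappa_mix \<alpha> p = measure_of (space boundary_space) (sets boundary_space) ?f"
    by (rule kappa_mix_def)
  show "sets boundary_space \<subseteq> Pow (space boundary_space)"
    by (rule sets.space_closed)
  show "positive (sets (kappa_mix \<alpha> p)) ?f"
    by (simp add: positive_def)
  \<comment> \<open>If this failed, \<open>measure_of\<close> would yield the zero measure.\<close>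
  show "countably_additive (sets (kappa_mix \<alpha> p)) ?f"
    unfolding countably_additive_def s
  proof safe
    fix A :: "nat \<Rightarrow> letter stream set"
    assume A: "range A \<subseteq> sets boundary_space" "disjoint_family A"
    have "sets (kappa \<alpha>) = sets boundary_space" "sets ?D = sets boundary_space"
      by (simp_all add: kappa_def)
    then have "(\<Sum>i. emeasure (kappa \<alpha>) (A i)) = emeasure (kappa \<alpha>) (\<Union>i. A i)"
      "(\<Sum>i. emeasure ?D (A i)) = emeasure ?D (\<Union>i. A i)"
      using A by (auto intro!: suminf_emeasure)
    then show "(\<Sum>i. ?f (A i)) = ?f (\<Union>i. A i)"
      by (simp add: suminf_add [symmetric] del: act_Cons)
  qed
  show "X \<in> sets (kappa_mix \<alpha> p)"
    using assms s by simp
qed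

lemma sets_kappa_mix [simp, measurable_cong]: "sets (kappa_mix \<alpha> p) = sets boundary_space"
  unfolding kappa_mix_def by (rule sets.sets_measure_of_eq)

lemma space_kappa_mix [simp]: "space (kappa_mix \<alpha> p) = boundary"
  using sets_eq_imp_space_eq [OF sets_kappa_mix] by simp

lemma emeasure_kappa_mix_kact:
  assumes X [measurable]: "X \<in> sets boundary_space" and p: "0 < p" "p < 1"
  shows "emeasure (kappa_mix \<alpha> p) X = ennreal (p * kact \<alpha> X [] + (1 - p) * kact \<alpha> X [La])"
proof -
  interpret prob_space "coin \<alpha>" by (rule prob_space_coin)
  have "emeasure (kappa \<alpha>) X = ennreal (kact \<alpha> X [])"
    unfolding kappa_def by (subst emeasure_distr) (auto simp: kact_def emeasure_eq_measure vimage_def)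
  moreover have "emeasure (distr (kappa \<alpha>) boundary_space (act [La])) X = ennreal (kact \<alpha> X [La])"
    unfolding kappa_def
    by (simp add: distr_distr emeasure_distr measurable_comp [OF measurable_coin_word measurable_act]
        kact_def emeasure_eq_measure vimage_def del: act_Cons)
  moreover have "0 \<le> kact \<alpha> X g" for g
    by (simp add: kact_def)
  ultimately show ?thesis
    using p by (simp add: emeasure_kappa_mix [OF X] ennreal_mult ennreal_plus)
qed

lemma kact_nonneg: "0 \<le> kact \<alpha> X g"
  by (simp add: kact_def)

lemma kact_UNIV:
  assumes "boundary \<subseteq> X" shows "kact \<alpha> X g = 1"
proof -
  interpret prob_space "coin \<alpha>" by (rule prob_space_coin)
  have "{\<beta>. act g (coin_word \<beta>) \<in> X} = space (coin \<alpha>)"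
    using assms coin_word_boundary act_boundary by auto
  then show ?thesis
    using prob_space by (simp add: kact_def)
qed

lemma measure_kappa_mix:
  assumes "X \<in> sets boundary_space" "0 < p" "p < 1"
  shows "measure (kappa_mix \<alpha> p) X = p * kact \<alpha> X [] + (1 - p) * kact \<alpha> X [La]"
  using assms
  by (simp add: measure_def emeasure_kappa_mix_kact kact_nonneg ennreal_plus [symmetric] del: ennreal_plus)

lemma prob_space_kappa_mix: "0 < p \<Longrightarrow> p < 1 \<Longrightarrow> prob_space (kappa_mix \<alpha> p)"
  using emeasure_kappa_mix_kact [of boundary p \<alpha>] sets.top [of boundary_space]
  by (intro prob_spaceI) (simp add: kact_UNIV)

section \<open>Cylinder sets and their exponential decay\<close>

definition cyl :: "letter list \<Rightarrow> letter stream set" where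
  "cyl w = {\<xi> \<in> boundary. stake (length w) \<xi> = w}"

lemma sets_cyl [measurable]: "cyl w \<in> sets boundary_space"
proof -
  have "stake (length w) \<in> boundary_space \<rightarrow>\<^sub>M count_space UNIV"
    by (intro measurable_from_boundary_space measurable_stake)
  from measurable_sets [OF this, of "{w}"] show ?thesis
    by (simp add: cyl_def vimage_def Int_def conj_commute)
qed

text \<open>Each pair of consecutive letters of \<open>w\<close> is either impossible or prescribes
  one toss, at the cost of a factor of at most \<open>max \<alpha> (1 - \<alpha>)\<close>.\<close>

lemma measure_coin_cyl_le:
  assumes \<alpha>: "0 < \<alpha>" "\<alpha> < 1"
  shows "measure (coin \<alpha>) {\<beta>. stake (length w) (coin_word \<beta>) = w} \<le> max \<alpha> (1 - \<alpha>) ^ (length w div 2)"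
proof (induction "length w" arbitrary: w rule: less_induct)
  case less
  interpret prob_space "coin \<alpha>" by (rule prob_space_coin)
  let ?c = "max \<alpha> (1 - \<alpha>)" and ?M = "measure (coin \<alpha>)"
  consider "length w div 2 = 0" | x y v where "w = x # y # v"
    by (cases w; cases "tl w") auto
  then show ?case
  proof cases
    case (2 x y v)
    have S: "{\<beta>. stake (length w) (coin_word \<beta>) = w} \<in> sets (coin \<alpha>)"
      using sets_coin_act [OF sets_cyl, of "[]" w \<alpha>] by (simp add: cyl_def coin_word_boundary)
    have IH: "?M {\<beta>. stake (length v) (coin_word \<beta>) = v} \<le> ?c ^ (length v div 2)"
      using less 2 by simp
    have "?M {\<beta>. stake (length w) (coin_word \<beta>) = w} =
      \<alpha> * ?M {\<beta>. La = x \<and> Lb = y \<and> stake (length v) (coin_word \<beta>) = v} +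
      (1 - \<alpha>) * ?M {\<beta>. La = x \<and> Lbi = y \<and> stake (length v) (coin_word \<beta>) = v}"
      using measure_coin_rec [OF S \<alpha>] by (simp add: coin_word_SCons 2)
    also have "\<dots> \<le> ?c * ?M {\<beta>. stake (length v) (coin_word \<beta>) = v}"
      by (cases x; cases y) (auto intro: mult_right_mono)
    also have "\<dots> \<le> ?c * ?c ^ (length v div 2)"
      using IH \<alpha> by (intro mult_left_mono) auto
    finally show ?thesis
      by (simp add: 2)
  qed simp
qed

lemma kappa_mix_cyl_le:
  assumes \<alpha>: "0 < \<alpha>" "\<alpha> < 1" and p: "0 < p" "p < 1"
  shows "measure (kappa_mix \<alpha> p) (cyl w) \<le> max \<alpha> (1 - \<alpha>) ^ (length w div 2)"
proof -
  let ?c = "max \<alpha> (1 - \<alpha>)"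
  have 1: "kact \<alpha> (cyl w) [] \<le> ?c ^ (length w div 2)"
    using measure_coin_cyl_le [OF \<alpha>, of w] by (simp add: kact_def cyl_def coin_word_boundary)
  \<comment> \<open>Acting by \<open>[La]\<close> deletes the leading \<open>La\<close>, so this is
    again a prefix condition on the coin word, one letter longer.\<close>
  have "act [La] (coin_word \<beta>) \<in> cyl w \<longleftrightarrow> stake (length (La # w)) (coin_word \<beta>) = La # w" for \<beta>
    using act_boundary [OF coin_word_boundary [of \<beta>], of "[La]"]
    by (simp add: cyl_def push_stream_def)
  then have "kact \<alpha> (cyl w) [La] \<le> ?c ^ (length (La # w) div 2)"
    using measure_coin_cyl_le [OF \<alpha>, of "La # w"] by (simp add: kact_def)
  also have "\<dots> \<le> ?c ^ (length w div 2)"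
    using \<alpha> by (intro power_decreasing) auto
  finally have 2: "kact \<alpha> (cyl w) [La] \<le> ?c ^ (length w div 2)" .
  have "measure (kappa_mix \<alpha> p) (cyl w) = p * kact \<alpha> (cyl w) [] + (1 - p) * kact \<alpha> (cyl w) [La]"
    using p by (simp add: measure_kappa_mix)
  also have "\<dots> \<le> p * ?c ^ (length w div 2) + (1 - p) * ?c ^ (length w div 2)"
    using p 1 2 by (intro add_mono mult_left_mono) auto
  finally show ?thesis
    by (simp add: algebra_simps)
qed

section \<open>Convergence to the boundary\<close>

text \<open>Replaces the quantifier over the uncountable set \<open>boundary\<close> by countable
  ones over finite prefixes, which makes convergence a measurable condition.\<close>

lemma converges_to_boundary_iff:
  "(\<exists>\<gamma>\<in>boundary. converges_to G \<gamma>) \<longleftrightarrow>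
     (\<forall>k. \<exists>w. alternating w \<and> length w = k \<and> (\<forall>\<^sub>F n in sequentially. take k (G n) = w))"
  (is "?L \<longleftrightarrow> ?R")
proof
  assume ?L
  then obtain \<gamma> where \<gamma>: "\<gamma> \<in> boundary" "converges_to G \<gamma>" by blast
  show ?R
  proof
    fix k
    have "alternating (stake k \<gamma>)"
      unfolding alternating_def
    proof (intro allI impI)
      fix i assume "Suc i < length (stake k \<gamma>)"
      then show "(stake k \<gamma> ! i = La) \<noteq> (stake k \<gamma> ! Suc i = La)"
        using \<gamma>(1) [unfolded boundary_iff, rule_format, of i]
        by (simp add: stake_nth del: snth.simps)
    qed
    then show "\<exists>w. alternating w \<and> length w = k \<and> (\<forall>\<^sub>F n in sequentially. take k (G n) = w)"
      using \<gamma>(2) by (intro exI [of _ "stake k \<gamma>"]) (simp add: converges_to_def)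
  qed
next
  assume ?R
  then obtain W where W: "\<And>k. alternating (W k)" "\<And>k. length (W k) = k"
    "\<And>k. \<forall>\<^sub>F n in sequentially. take k (G n) = W k"
    by metis
  \<comment> \<open>The letter at index \<open>i\<close> is read off the shortest stabilized prefix
    that contains it.\<close>
  define \<gamma> where "\<gamma> = to_stream (\<lambda>i. W (Suc i) ! i)"
  have stake: "stake k \<gamma> = W k" for k
  proof (rule nth_equalityI)
    fix i assume "i < length (stake k \<gamma>)"
    then have i: "i < k" by simp
    have "\<forall>\<^sub>F n in sequentially. take k (G n) = W k \<and> take (Suc i) (G n) = W (Suc i)"
      using W(3) [of k] W(3) [of "Suc i"] by (rule eventually_conj)
    then obtain n where n: "take k (G n) = W k" "take (Suc i) (G n) = W (Suc i)"
      by (auto simp: eventually_sequentially)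
    have "stake k \<gamma> ! i = W (Suc i) ! i"
      using i by (simp add: \<gamma>_def to_stream_def)
    also have "\<dots> = W k ! i"
      using n i by (metis lessI nth_take)
    finally show "stake k \<gamma> ! i = W k ! i" .
  qed (simp add: W)
  have "(\<gamma> !! i = La) \<noteq> (\<gamma> !! Suc i = La)" for i
    using W(1) [of "Suc (Suc i)", unfolded stake [symmetric] alternating_def, rule_format, of i]
    by (simp add: stake_nth del: snth.simps stake.simps)
  then have "\<gamma> \<in> boundary"
    unfolding boundary_iff by blast
  moreover have "converges_to G \<gamma>"
    using W(3) by (simp add: converges_to_def stake)
  ultimately show ?L
    by blast
qed

lemma converges_to_unique:
  assumes "converges_to G \<gamma>" "converges_to G \<gamma>'"
  shows "\<gamma> = \<gamma>'"
proof -
  have "stake k \<gamma> = stake k \<gamma>'" for k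
  proof -
    have "\<forall>\<^sub>F n in sequentially. take k (G n) = stake k \<gamma> \<and> take k (G n) = stake k \<gamma>'"
      using assms unfolding converges_to_def by (intro eventually_conj) blast+
    then show ?thesis
      by (auto simp: eventually_sequentially)
  qed
  then have "\<gamma> !! n = \<gamma>' !! n" for n
    by (metis lessI stake_nth)
  then show ?thesis
    using smap_alt [of id \<gamma> \<gamma>'] by (simp add: stream.map_id)
qed

lemma limit_point_eq:
  assumes "\<gamma> \<in> boundary" "converges_to (walk \<omega>) \<gamma>"
  shows "limit_point \<omega> = \<gamma>"
  using assms converges_to_unique unfolding limit_point_def
  by (auto intro!: the_equality)

text \<open>A right multiplication by a short word changes only the end of a long word.\<close>

lemma converges_to_boundary:
  assumes alt: "\<And>n. alternating (G n)" "\<And>n. alternating (h n)"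
    and step: "\<And>n. G (Suc n) = G n \<cdot> h n"
    and len: "\<And>n. length (h n) \<le> R"
    and trans: "\<And>g. alternating g \<Longrightarrow> \<forall>\<^sub>F n in sequentially. G n \<noteq> g"
  shows "\<exists>\<gamma>\<in>boundary. converges_to G \<gamma>"
  unfolding converges_to_boundary_iff
proof
  fix k
  \<comment> \<open>These finitely many words are the ones too short for \<open>take_mult\<close>;
    transience makes the walk avoid all of them from some time on.\<close>
  let ?B = "{w. alternating w \<and> length w \<le> k + R}"
  have "finite {w :: letter list. set w \<subseteq> UNIV \<and> length w \<le> k + R}"
    by (rule finite_lists_length_le) simp
  then have "finite ?B"
    by (rule rev_finite_subset) auto
  then have "\<forall>\<^sub>F n in sequentially. \<forall>g\<in>?B. G n \<noteq> g"
    by (rule eventually_ball_finite) (use trans in auto)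
  then obtain N where N: "\<And>n. n \<ge> N \<Longrightarrow> G n \<notin> ?B"
    unfolding eventually_sequentially by blast
  have long: "k + R < length (G n)" if "n \<ge> N" for n
    using N [OF that] alt(1) [of n] by auto
  have "take k (G n) = take k (G N)" if "n \<ge> N" for n
    using that
  proof (induction n rule: dec_induct)
    case (step n)
    have "take k (G (Suc n)) = take k (G n)"
      using long [of n] len [of n] step alt by (simp add: assms(3) take_mult)
    with step show ?case by simp
  qed simp
  moreover have "alternating (take k (G N))"
    using alt(1) [of N] by (metis alternating_append append_take_drop_id)
  moreover have "length (take k (G N)) = k"
    using long [of N] by simp
  ultimately show "\<exists>w. alternating w \<and> length w = k \<and> (\<forall>\<^sub>F n in sequentially. take k (G n) = w)"
    unfolding eventually_sequentially by blast
qed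

lemma cycle_boundary: "cycle [La, Lb] \<in> boundary"
proof -
  have eq: "cycle [La, Lb] = La ## cycle [Lb, La]" "cycle [Lb, La] = Lb ## cycle [La, Lb]"
    using cycle_Cons [of La "[Lb]"] cycle_Cons [of Lb "[La]"] by simp_all
  have sel: "shd (cycle [La, Lb]) = La" "shd (cycle [Lb, La]) = Lb"
    "stl (cycle [La, Lb]) = cycle [Lb, La]" "stl (cycle [Lb, La]) = cycle [La, Lb]"
    using eq by (metis stream.sel)+
  have "s = cycle [La, Lb] \<or> s = cycle [Lb, La] \<Longrightarrow> (s !! i = La) \<noteq> (s !! Suc i = La)" for i s
  proof (induction i arbitrary: s)
    case 0
    then show ?case by (auto simp: sel)
  next
    case (Suc i)
    then have "stl s = cycle [La, Lb] \<or> stl s = cycle [Lb, La]"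
      by (auto simp: sel)
    from Suc.IH [OF this] show ?case by simp
  qed
  then show ?thesis
    unfolding boundary_iff by blast
qed

lemma limit_point_boundary: "limit_point \<omega> \<in> boundary"
proof (cases "\<exists>\<gamma>\<in>boundary. converges_to (walk \<omega>) \<gamma>")
  case True
  then show ?thesis using limit_point_eq by auto
next
  case False
  then show ?thesis by (simp add: limit_point_def cycle_boundary)
qed

text \<open>By \<open>converges_to_boundary_iff\<close>, both convergence and the letters of the
  limit are countable combinations of conditions on finitely many increments.\<close>

lemma measurable_limit_point [measurable]:
  "limit_point \<in> stream_space (measure_pmf \<mu>) \<rightarrow>\<^sub>M boundary_space"
proof (rule measurable_boundary_spaceI)
  let ?S = "stream_space (measure_pmf \<mu>)"
  let ?E = "\<lambda>\<omega> k w. \<forall>\<^sub>F n in sequentially. take k (walk \<omega> n) = w"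
  let ?C = "\<lambda>\<omega>. \<forall>k. \<exists>w. alternating w \<and> length w = k \<and> ?E \<omega> k w"
  have stake: "stake n \<in> ?S \<rightarrow>\<^sub>M count_space UNIV" for n
  proof -
    have "sets ?S = sets (stream_space (count_space UNIV))"
      by (rule sets_stream_space_cong) simp
    then show ?thesis
      using measurable_stake [of n] measurable_cong_sets by blast
  qed
  have "(\<lambda>\<omega>. take k (walk \<omega> n) = w) \<in> ?S \<rightarrow>\<^sub>M count_space UNIV" for k w n
    unfolding walk_def
    by (rule measurable_compose [OF stake measurable_count_space [of "\<lambda>xs. take k (foldr _ xs _) = w"]])
  then have E: "Measurable.pred ?S (\<lambda>\<omega>. ?E \<omega> k w)" for k w
    unfolding eventually_sequentially
    by (intro pred_intros_countable pred_intros_logic(4)) auto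
  have C: "Measurable.pred ?S ?C"
    by (intro pred_intros_countable pred_intros_logic(3) E measurable_const) simp_all
  show "limit_point \<in> ?S \<rightarrow>\<^sub>M stream_space (count_space UNIV)"
  proof (rule measurable_stream_space2)
    fix i
    \<comment> \<open>On convergent paths letter \<open>i\<close> is determined by the limiting
      prefix of length \<open>Suc i\<close>, on the others by the default word.\<close>
    have *: "limit_point \<omega> !! i = c \<longleftrightarrow>
      (?C \<omega> \<and> (\<exists>w. w ! i = c \<and> length w = Suc i \<and> ?E \<omega> (Suc i) w)) \<or>
      (\<not> ?C \<omega> \<and> cycle [La, Lb] !! i = c)" for \<omega> c
    proof (cases "?C \<omega>")
      case True
      then obtain \<gamma> where \<gamma>: "\<gamma> \<in> boundary" "converges_to (walk \<omega>) \<gamma>"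
        using converges_to_boundary_iff by blast
      then have l: "limit_point \<omega> = \<gamma>"
        by (rule limit_point_eq)
      have E: "?E \<omega> (Suc i) (stake (Suc i) \<gamma>)"
        using \<gamma>(2) unfolding converges_to_def by blast
      have "w = stake (Suc i) \<gamma>" if "?E \<omega> (Suc i) w" for w
        using eventually_conj [OF E that] by (auto simp: eventually_sequentially)
      then have "(\<exists>w. w ! i = c \<and> length w = Suc i \<and> ?E \<omega> (Suc i) w) \<longleftrightarrow>
          stake (Suc i) \<gamma> ! i = c \<and> length (stake (Suc i) \<gamma>) = Suc i \<and> ?E \<omega> (Suc i) (stake (Suc i) \<gamma>)"
        by blast
      also have "\<dots> \<longleftrightarrow> limit_point \<omega> !! i = c"
        using E by (simp add: l del: stake.simps snth.simps)
      finally show ?thesis using True by blast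
    next
      case False
      then have "\<not> (\<exists>\<gamma>\<in>boundary. converges_to (walk \<omega>) \<gamma>)"
        using converges_to_boundary_iff by blast
      then have "limit_point \<omega> = cycle [La, Lb]"
        unfolding limit_point_def by (rule if_not_P)
      then have l: "limit_point \<omega> !! i = cycle [La, Lb] !! i"
        by simp
      show ?thesis
        unfolding l using False by blast
    qed
    have "(\<lambda>\<omega>. limit_point \<omega> !! i) -` {c} \<inter> space ?S \<in> sets ?S" for c
    proof -
      have "Measurable.pred ?S (\<lambda>\<omega>. limit_point \<omega> !! i = c)"
        unfolding * by (intro pred_intros_countable pred_intros_logic(2,3,5) E C measurable_const) simp_all
      then show ?thesis
        by (simp add: pred_def vimage_def Int_def conj_commute)
    qed
    then show "(\<lambda>\<omega>. limit_point \<omega> !! i) \<in> ?S \<rightarrow>\<^sub>M count_space UNIV"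
      by (simp add: measurable_count_space_eq2_countable)
  qed
qed (rule limit_point_boundary)

text \<open>Probability measures on the full stream space are determined by the sets
  \<open>sstart\<close>. Both measures are pushed forward along the inclusion of
  \<open>boundary\<close>, under which the preimages of these sets are the cylinders.\<close>

lemma boundary_measure_eqI:
  assumes M: "prob_space M" "sets M = sets boundary_space"
    and N: "prob_space N" "sets N = sets boundary_space"
    and eq: "\<And>w. emeasure M (cyl w) = emeasure N (cyl w)"
  shows "M = N"
proof -
  let ?S = "stream_space (count_space UNIV) :: letter stream measure"
  have id: "(\<lambda>x. x) \<in> K \<rightarrow>\<^sub>M ?S" if "sets K = sets boundary_space" for K
    using measurable_from_boundary_space [OF measurable_ident_sets [OF refl]]
      measurable_cong_sets [OF that refl] by blast
  have sp: "space M = boundary" "space N = boundary"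
    using M(2) N(2) sets_eq_imp_space_eq space_boundary_space by blast+
  have cyl: "sstart UNIV w \<inter> boundary = cyl w" for w
    by (auto simp: sstart_eq cyl_def list_eq_iff_nth_eq stake_nth)
  have "distr M ?S (\<lambda>x. x) = distr N ?S (\<lambda>x. x)"
  proof (rule stream_space_eq_sstart [of UNIV])
    show "prob_space (distr M ?S (\<lambda>x. x))" "prob_space (distr N ?S (\<lambda>x. x))"
      using M N by (auto intro: prob_space.prob_space_distr id)
    show "emeasure (distr M ?S (\<lambda>x. x)) (sstart UNIV w) = emeasure (distr N ?S (\<lambda>x. x)) (sstart UNIV w)"
      for w
      using M N by (simp add: emeasure_distr id sets_sstart sp cyl eq)
  qed auto
  then have D: "emeasure (distr M ?S (\<lambda>x. x)) Y = emeasure (distr N ?S (\<lambda>x. x)) Y" for Y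
    by simp
  show ?thesis
  proof (rule measure_eqI)
    fix X assume "X \<in> sets M"
    then obtain Y where Y: "Y \<in> sets ?S" "X = Y \<inter> boundary"
      using M(2) by (auto simp: boundary_space_def sets_restrict_space)
    then show "emeasure M X = emeasure N X"
      using D [of Y] M N by (simp add: emeasure_distr id sp)
  qed (simp add: M N)
qed

section \<open>Stationary measures are harmonic measures\<close>

text \<open>For finitely supported \<open>\<mu>\<close>, the Markov operator of the walk with right
  increments: the expectation of \<open>f\<close> after one step from \<open>g\<close>.\<close>

definition mop :: "letter list pmf \<Rightarrow> (letter list \<Rightarrow> real) \<Rightarrow> letter list \<Rightarrow> real" where
  "mop \<mu> f g = (\<Sum>h\<in>set_pmf \<mu>. pmf \<mu> h * f (g \<cdot> h))"

text \<open>Stationarity yields bounded harmonic functions, and non-invariance a non-constant one.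
  The bound \<open>cyl_le\<close> is a quantitative absence of atoms, which controls translates by
  long words.\<close>

locale stationary_walk =
  fixes \<mu> :: "letter list pmf" and \<nu> :: "letter stream measure" and c :: real
  assumes finite_supp: "finite (set_pmf \<mu>)"
    and nondeg: "nondegenerate \<mu>"
    and prob_space_nu: "prob_space \<nu>"
    and sets_nu: "sets \<nu> = sets boundary_space"
    and stationary: "\<And>X. X \<in> sets boundary_space \<Longrightarrow>
      measure \<nu> X = (\<Sum>h\<in>set_pmf \<mu>. pmf \<mu> h * measure \<nu> (act h -` X \<inter> boundary))"
    and not_invariant: "\<exists>g\<in>carrier Gamma. \<exists>X\<in>sets boundary_space.
      measure \<nu> (act g -` X \<inter> boundary) \<noteq> measure \<nu> X"
    and cyl_le: "\<And>w. measure \<nu> (cyl w) \<le> c ^ (length w div 2)"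
    and c: "0 < c" "c < 1"
begin

interpretation nu: prob_space \<nu>
  by (rule prob_space_nu)

lemma space_nu: "space \<nu> = boundary"
  using sets_eq_imp_space_eq [OF sets_nu] by simp

lemma supp_alternating: "h \<in> set_pmf \<mu> \<Longrightarrow> alternating h"
  using nondeg semigroup_span.incl [of h "set_pmf \<mu>" Gamma]
  by (simp add: nondegenerate_def flip: carrier_Gamma)

lemma pmf_sum: "(\<Sum>h\<in>set_pmf \<mu>. pmf \<mu> h) = 1"
  using finite_supp by (intro sum_pmf_eq_1) auto

section \<open>Harmonic functions of the walk\<close>

text \<open>The mass of \<open>X\<close> under the translate of \<open>\<nu>\<close> by
  \<open>g\<close>, that is, the Poisson transform of the indicator of \<open>X\<close>.\<close>

definition u :: "letter stream set \<Rightarrow> letter list \<Rightarrow> real" where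
  "u X g = measure \<nu> (act g -` X \<inter> boundary)"

lemma sets_act_vimage: "X \<in> sets boundary_space \<Longrightarrow> act g -` X \<inter> boundary \<in> sets boundary_space"
  using measurable_sets [OF measurable_act, of X g] by simp

text \<open>Moves the base point: the function seen from \<open>g\<close> is the one belonging to a
  pulled-back set.\<close>

lemma u_mult: "u X (g \<cdot> h) = u (act g -` X \<inter> boundary) h"
  unfolding u_def by (rule arg_cong [of _ _ "measure \<nu>"]) (auto simp: act_mult act_boundary)

lemma u_Nil: "X \<in> sets boundary_space \<Longrightarrow> u X [] = measure \<nu> X"
  using sets.sets_into_space [of X boundary_space]
  by (simp add: u_def Int_absorb2 vimage_def)

lemma u_bounds: "0 \<le> u X g" "u X g \<le> 1"
  by (simp_all add: u_def)

lemma mop_u: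
  assumes "X \<in> sets boundary_space" shows "mop \<mu> (u X) = u X"
proof
  fix g
  have "u X g = measure \<nu> (act g -` X \<inter> boundary)"
    by (simp add: u_def)
  also have "\<dots> = (\<Sum>h\<in>set_pmf \<mu>. pmf \<mu> h * u (act g -` X \<inter> boundary) h)"
    using stationary [OF sets_act_vimage [OF assms]] by (simp add: u_def)
  also have "\<dots> = mop \<mu> (u X) g"
    by (simp add: mop_def u_mult)
  finally show "mop \<mu> (u X) g = u X g" by simp
qed

lemma funpow_mop_u: "X \<in> sets boundary_space \<Longrightarrow> (mop \<mu> ^^ n) (u X) = u X"
  by (induction n) (simp_all add: mop_u)

lemma mop_add: "mop \<mu> (\<lambda>g. f g + k g) = (\<lambda>g. mop \<mu> f g + mop \<mu> k g)"
  by (simp add: mop_def fun_eq_iff algebra_simps sum.distrib)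

lemma mop_cmult: "mop \<mu> (\<lambda>g. r * f g) = (\<lambda>g. r * mop \<mu> f g)"
  by (simp add: mop_def fun_eq_iff sum_distrib_left algebra_simps)

lemma mop_const: "mop \<mu> (\<lambda>g. r) = (\<lambda>g. r)"
  by (simp add: mop_def fun_eq_iff sum_distrib_right [symmetric] pmf_sum)

lemma funpow_mop_add:
  "(mop \<mu> ^^ n) (\<lambda>g. f g + k g) = (\<lambda>g. (mop \<mu> ^^ n) f g + (mop \<mu> ^^ n) k g)"
  by (induction n) (simp_all add: mop_add)

lemma funpow_mop_cmult: "(mop \<mu> ^^ n) (\<lambda>g. r * f g) = (\<lambda>g. r * (mop \<mu> ^^ n) f g)"
  by (induction n) (simp_all add: mop_cmult)

lemma funpow_mop_const: "(mop \<mu> ^^ n) (\<lambda>g. r) = (\<lambda>g. r)"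
  by (induction n) (simp_all add: mop_const)

lemma funpow_mop_sum:
  "finite B \<Longrightarrow> (mop \<mu> ^^ n) (\<lambda>g. \<Sum>b\<in>B. f b g) = (\<lambda>g. \<Sum>b\<in>B. (mop \<mu> ^^ n) (f b) g)"
  by (induction B rule: finite_induct) (simp_all add: funpow_mop_add funpow_mop_const)

lemma mop_mono:
  assumes "\<And>g. alternating g \<Longrightarrow> f g \<le> k g" "alternating g"
  shows "mop \<mu> f g \<le> mop \<mu> k g"
  unfolding mop_def
  by (intro sum_mono mult_left_mono assms alternating_mult supp_alternating) auto

lemma funpow_mop_mono:
  assumes "\<And>g. alternating g \<Longrightarrow> f g \<le> k g" "alternating g"
  shows "(mop \<mu> ^^ n) f g \<le> (mop \<mu> ^^ n) k g"
  using assms(2) by (induction n arbitrary: g) (auto intro: mop_mono assms(1))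

section \<open>Energy and transience\<close>

text \<open>For measurable \<open>X\<close> the values of \<open>u X\<close> along the walk form a
  bounded martingale; this is the conditional variance of its next increment at
  \<open>g\<close>.\<close>

definition energy :: "letter stream set \<Rightarrow> letter list \<Rightarrow> real" where
  "energy X g = (\<Sum>h\<in>set_pmf \<mu>. pmf \<mu> h * (u X (g \<cdot> h) - u X g)\<^sup>2)"

lemma energy_nonneg: "0 \<le> energy X g"
  by (simp add: energy_def sum_nonneg)

text \<open>Expand the squares in \<open>energy X g\<close>; harmonicity of \<open>u X\<close>
  evaluates the cross term.\<close>

lemma mop_u_square:
  assumes "X \<in> sets boundary_space"
  shows "mop \<mu> (\<lambda>g. (u X g)\<^sup>2) = (\<lambda>g. (u X g)\<^sup>2 + energy X g)"
proof
  fix g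
  have eq: "(\<Sum>h\<in>set_pmf \<mu>. pmf \<mu> h * u X (g \<cdot> h)) = u X g"
    using fun_cong [OF mop_u [OF assms], of g] by (simp add: mop_def)
  have "energy X g = (\<Sum>h\<in>set_pmf \<mu>. pmf \<mu> h * (u X (g \<cdot> h))\<^sup>2
      - 2 * u X g * (pmf \<mu> h * u X (g \<cdot> h)) + (u X g)\<^sup>2 * pmf \<mu> h)"
    unfolding energy_def by (intro sum.cong) (auto simp: power2_eq_square algebra_simps)
  also have "\<dots> = mop \<mu> (\<lambda>g. (u X g)\<^sup>2) g - 2 * u X g * u X g + (u X g)\<^sup>2"
    by (simp add: sum.distrib sum_subtractf mop_def eq pmf_sum flip: sum_distrib_left)
  finally show "mop \<mu> (\<lambda>g. (u X g)\<^sup>2) g = (u X g)\<^sup>2 + energy X g"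
    by (simp add: power2_eq_square)
qed

text \<open>By \<open>mop_u_square\<close> the sum telescopes to the \<open>n\<close>-step average
  of the squared function minus its initial value, and \<open>u X\<close> takes values between 0 and
  1.\<close>

lemma energy_sum_le:
  assumes "X \<in> sets boundary_space"
  shows "(\<Sum>k<n. (mop \<mu> ^^ k) (energy X) g) \<le> 1"
proof -
  have "(\<Sum>k<n. (mop \<mu> ^^ k) (energy X) g) = (mop \<mu> ^^ n) (\<lambda>g. (u X g)\<^sup>2) g - (u X g)\<^sup>2"
  proof (induction n)
    case (Suc n)
    have "(mop \<mu> ^^ Suc n) (\<lambda>g. (u X g)\<^sup>2) = (mop \<mu> ^^ n) (\<lambda>g. (u X g)\<^sup>2 + energy X g)"
      using assms by (simp only: funpow_Suc_right comp_apply mop_u_square)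
    with Suc show ?case
      by (simp add: funpow_mop_add)
  qed simp
  also have "(mop \<mu> ^^ n) (\<lambda>g. (u X g)\<^sup>2) g \<le> 1"
  proof -
    have "mop \<mu> f g \<le> 1" if "\<And>g. f g \<le> 1" for f g
    proof -
      have "mop \<mu> f g \<le> (\<Sum>h\<in>set_pmf \<mu>. pmf \<mu> h * 1)"
        unfolding mop_def by (intro sum_mono mult_left_mono that) auto
      then show ?thesis by (simp add: pmf_sum)
    qed
    then have "(mop \<mu> ^^ n) f g \<le> 1" if "\<And>g. f g \<le> 1" for f g
      using that by (induction n arbitrary: g) auto
    then show ?thesis
      using u_bounds by (simp add: power_le_one)
  qed
  finally show ?thesis
    by (smt (verit) zero_le_power2)
qed

text \<open>The elements preserving \<open>\<nu>\<close> are closed under products, so by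
  non-degeneracy invariance under the support would spread to the whole group.\<close>

lemma supp_not_invariant:
  obtains h X where "h \<in> set_pmf \<mu>" "X \<in> sets boundary_space" "u X h \<noteq> u X []"
proof (rule ccontr)
  assume "\<not> thesis"
  with that have inv: "u X h = u X []" if "h \<in> set_pmf \<mu>" "X \<in> sets boundary_space" for h X
    using that by blast
  have "\<forall>X\<in>sets boundary_space. u X g = u X []" if "g \<in> semigroup_span Gamma (set_pmf \<mu>)" for g
    using that
  proof (induction rule: semigroup_span.induct)
    case (incl x)
    then show ?case using inv by blast
  next
    case (mult x y)
    show ?case
    proof
      fix X assume X: "X \<in> sets boundary_space"
      let ?Y = "act x -` X \<inter> boundary"
      have Y: "?Y \<in> sets boundary_space"
        using X by (rule sets_act_vimage)
      have "u X (x \<cdot> y) = u ?Y y"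
        by (rule u_mult)
      also have "\<dots> = u ?Y []"
        using mult.IH(2) Y by blast
      also have "\<dots> = u X x"
        using u_Nil [OF Y] by (simp add: u_def)
      also have "\<dots> = u X []"
        using mult.IH(1) X by blast
      finally show "u X (x \<otimes>\<^bsub>Gamma\<^esub> y) = u X []"
        by simp
    qed
  qed
  then show False
    using not_invariant nondeg u_Nil by (auto simp: nondegenerate_def u_def)
qed

text \<open>Take a step \<open>h\<close> from the identity that changes \<open>u X\<close>, and pull
  \<open>X\<close> back by the inverse of \<open>g\<close>: the same step from \<open>g\<close> then
  changes the new function equally.\<close>

lemma energy_pos:
  assumes "alternating g"
  obtains X where "X \<in> sets boundary_space" "0 < energy X g"
proof -
  obtain h X where h: "h \<in> set_pmf \<mu>" and X: "X \<in> sets boundary_space" and ne: "u X h \<noteq> u X []"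
    by (rule supp_not_invariant)
  define Y where "Y = act (winv g) -` X \<inter> boundary"
  have Y: "Y \<in> sets boundary_space"
    unfolding Y_def using X by (rule sets_act_vimage)
  have uY: "u Y v = u X (winv g \<cdot> v)" for v
    by (simp add: Y_def u_mult)
  have "winv g \<cdot> (g \<cdot> h) = h"
    using supp_alternating [OF h] by (simp add: winv_mult flip: mult_assoc)
  with ne have "u Y (g \<cdot> h) \<noteq> u Y g"
    by (simp add: uY winv_mult)
  then have "0 < pmf \<mu> h * (u Y (g \<cdot> h) - u Y g)\<^sup>2"
    using h by (simp add: pmf_positive)
  also have "\<dots> \<le> energy Y g"
    unfolding energy_def using h finite_supp
    by (intro member_le_sum) auto
  finally show thesis
    using that Y by blast
qed

text \<open>Green's function is finite: a walk returning to \<open>g\<close> too often would accumulate more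
  than the total energy of a bounded harmonic function.\<close>

lemma summable_funpow_mop:
  assumes "alternating g" and "alternating x"
  shows "summable (\<lambda>n. (mop \<mu> ^^ n) (indicator {g}) x)"
proof -
  obtain X where X: "X \<in> sets boundary_space" "0 < energy X g"
    using energy_pos [OF assms(1)] by blast
  have nonneg: "0 \<le> (mop \<mu> ^^ n) (indicator {g}) x" for n
    using funpow_mop_mono [OF _ assms(2), of "\<lambda>g. 0" "indicator {g}" n] by (simp add: funpow_mop_const)
  \<comment> \<open>Being nonnegative, \<open>energy X\<close> dominates its value at
    \<open>g\<close> times the indicator of \<open>{g}\<close>, and powers of
    \<open>mop \<mu>\<close> are monotone.\<close>
  have le: "energy X g * (mop \<mu> ^^ n) (indicator {g}) x \<le> (mop \<mu> ^^ n) (energy X) x" for n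
    using funpow_mop_mono [OF _ assms(2), of "\<lambda>v. energy X g * indicator {g} v" "energy X" n]
    by (simp add: funpow_mop_cmult energy_nonneg split: split_indicator)
  show ?thesis
  proof (rule summableI_nonneg_bounded [OF nonneg])
    fix n
    have "energy X g * (\<Sum>k<n. (mop \<mu> ^^ k) (indicator {g}) x) \<le> (\<Sum>k<n. (mop \<mu> ^^ k) (energy X) x)"
      unfolding sum_distrib_left by (intro sum_mono le)
    also have "\<dots> \<le> 1"
      using X(1) by (rule energy_sum_le)
    finally show "(\<Sum>k<n. (mop \<mu> ^^ k) (indicator {g}) x) \<le> 1 / energy X g"
      using X(2) by (simp add: field_simps)
  qed
qed

section \<open>The walk on its path space\<close>

abbreviation S :: "letter list stream measure" where
  "S \<equiv> stream_space (measure_pmf \<mu>)"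

text \<open>Unlike \<open>walk\<close>, which folds from the right, this form has a free starting
  point and appends one increment per step. By \<open>walk_eq_rwalk\<close> both agree on
  alternating increments when the start is \<open>[]\<close>.\<close>

definition rwalk :: "letter list \<Rightarrow> letter list stream \<Rightarrow> nat \<Rightarrow> letter list" where
  "rwalk x \<omega> n = foldl (\<cdot>) x (stake n \<omega>)"

interpretation S: prob_space S
  by (rule prob_space.prob_space_stream_space [OF prob_space_measure_pmf])

lemma space_S [simp]: "space S = UNIV"
  by (simp add: space_stream_space)

lemma measurable_rwalk [measurable]: "(\<lambda>\<omega>. rwalk x \<omega> n) \<in> S \<rightarrow>\<^sub>M count_space UNIV"
proof -
  have [measurable]: "stake n \<in> S \<rightarrow>\<^sub>M count_space UNIV" for n
    using measurable_stake [of n] by (simp cong: measurable_cong_sets sets_stream_space_cong)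
  show ?thesis
    unfolding rwalk_def by measurable
qed

text \<open>Conditioning on the first increment \<open>t\<close> moves the starting point to
  \<open>x \<cdot> t\<close>, hence the induction with arbitrary \<open>x\<close>.\<close>

lemma measure_rwalk:
  "measure S {\<omega>. rwalk x \<omega> n \<in> B} = (mop \<mu> ^^ n) (indicator B) x"
proof (induction n arbitrary: x)
  case 0
  then show ?case
    using S.prob_space by (auto simp: rwalk_def indicator_def)
next
  case (Suc n)
  have sets: "{\<omega>. rwalk x \<omega> n \<in> B} \<in> sets S" for x n
    using measurable_sets [OF measurable_rwalk, of B x n] by (simp add: vimage_def)
  have nonneg: "0 \<le> (mop \<mu> ^^ n) (indicator B) y" for y
    using measure_nonneg [of S "{\<omega>. rwalk y \<omega> n \<in> B}"] by (simp only: Suc.IH)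
  have rec: "(mop \<mu> ^^ Suc n) (indicator B) x =
      (\<Sum>t\<in>set_pmf \<mu>. (mop \<mu> ^^ n) (indicator B) (x \<cdot> t) * pmf \<mu> t)"
    by (simp add: mop_def [of \<mu> "(mop \<mu> ^^ n) (indicator B)"] mult.commute)
  have "ennreal (measure S {\<omega>. rwalk x \<omega> (Suc n) \<in> B}) =
      (\<integral>\<^sup>+t. emeasure S {\<omega>. rwalk (x \<cdot> t) \<omega> n \<in> B} \<partial>\<mu>)"
    using prob_space.emeasure_stream_space [OF prob_space_measure_pmf sets [of x "Suc n"]]
    by (simp add: rwalk_def S.emeasure_eq_measure)
  also have "\<dots> = (\<Sum>t\<in>set_pmf \<mu>. ennreal ((mop \<mu> ^^ n) (indicator B) (x \<cdot> t)) * ennreal (pmf \<mu> t))"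
    by (simp add: nn_integral_measure_pmf_finite finite_supp S.emeasure_eq_measure Suc)
  also have "\<dots> = ennreal ((mop \<mu> ^^ Suc n) (indicator B) x)"
    unfolding rec by (simp add: ennreal_mult [symmetric] sum_ennreal nonneg)
  finally show ?case
    unfolding rec
    by (subst (asm) ennreal_inj) (auto intro!: sum_nonneg mult_nonneg_nonneg nonneg)
qed

lemma rwalk_Suc: "rwalk x \<omega> (Suc n) = rwalk x \<omega> n \<cdot> (\<omega> !! n)"
  by (simp add: rwalk_def stake_Suc del: stake.simps)

lemma foldr_gmult: "alternating h \<Longrightarrow> foldr (\<cdot>) xs h = foldr (\<cdot>) xs [] \<cdot> h"
  by (induction xs) (simp_all add: mult_assoc)

lemma walk_eq_rwalk:
  assumes "\<And>i. alternating (\<omega> !! i)"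
  shows "walk \<omega> n = rwalk [] \<omega> n"
proof (induction n)
  case (Suc n)
  have "walk \<omega> (Suc n) = foldr (\<cdot>) (stake n \<omega>) (\<omega> !! n \<cdot> [])"
    by (simp add: walk_def stake_Suc del: stake.simps)
  also have "\<dots> = walk \<omega> n \<cdot> (\<omega> !! n)"
    by (subst foldr_gmult) (simp_all add: mult_Nil_right assms walk_def)
  finally show ?case
    by (simp add: rwalk_Suc Suc)
qed (simp add: walk_def rwalk_def)

lemma rwalk_alternating:
  assumes "\<And>i. alternating (\<omega> !! i)"
  shows "alternating (rwalk [] \<omega> n)"
proof (induction n)
  case (Suc n)
  show ?case unfolding rwalk_Suc by (intro alternating_mult assms)
qed (simp add: rwalk_def)

lemma AE_in_supp: "AE \<omega> in S. \<forall>i. \<omega> !! i \<in> set_pmf \<mu>"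
proof -
  have "AE \<omega> in S. stream_all (\<lambda>h. h \<in> set_pmf \<mu>) \<omega>"
    by (rule prob_space.AE_stream_all [OF prob_space_measure_pmf]) (auto simp: AE_measure_pmf)
  then show ?thesis
    by eventually_elim (metis snth_sset stream_all_def)
qed

text \<open>Borel-Cantelli with the finite Green's function; as there are countably many words, one
  null set serves all \<open>g\<close>.\<close>

lemma AE_transient: "AE \<omega> in S. \<forall>g. alternating g \<longrightarrow> (\<forall>\<^sub>F n in sequentially. rwalk [] \<omega> n \<noteq> g)"
  unfolding AE_all_countable
proof
  fix g
  show "AE \<omega> in S. alternating g \<longrightarrow> (\<forall>\<^sub>F n in sequentially. rwalk [] \<omega> n \<noteq> g)"
  proof (cases "alternating g")
    case True
    have "AE \<omega> in S. \<forall>\<^sub>F n in sequentially. \<omega> \<in> space S - {\<omega>. rwalk [] \<omega> n \<in> {g}}"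
    proof (rule borel_cantelli_AE1)
      show "{\<omega>. rwalk [] \<omega> n \<in> {g}} \<in> sets S" for n
        using measurable_sets [OF measurable_rwalk, of "{g}" "[]" n] by (simp add: vimage_def)
      show "summable (\<lambda>n. measure S {\<omega>. rwalk [] \<omega> n \<in> {g}})"
        unfolding measure_rwalk using True by (intro summable_funpow_mop) auto
    qed (simp add: S.emeasure_eq_measure)
    then show ?thesis by simp
  qed simp
qed

lemma AE_converges:
  "AE \<omega> in S. limit_point \<omega> \<in> boundary \<and> converges_to (rwalk [] \<omega>) (limit_point \<omega>)"
  using AE_in_supp AE_transient
proof eventually_elim
  case (elim \<omega>)
  have alt: "alternating (\<omega> !! i)" for i
    using elim supp_alternating by blast
  have "\<exists>\<gamma>\<in>boundary. converges_to (rwalk [] \<omega>) \<gamma>"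
  proof (rule converges_to_boundary)
    show "length (\<omega> !! n) \<le> Max (length ` set_pmf \<mu>)" for n
      using elim finite_supp by (intro Max_ge) auto
  qed (use elim alt in \<open>auto simp: rwalk_Suc rwalk_alternating\<close>)
  moreover have "walk \<omega> = rwalk [] \<omega>"
    using walk_eq_rwalk [OF alt] by blast
  ultimately show ?case
    using limit_point_eq [of _ \<omega>] by auto
qed

section \<open>Identification of the limit law\<close>

text \<open>By \<open>stake_act\<close>, the points whose image under \<open>g\<close> does not
  begin like \<open>g\<close> lie in the cylinder of an inverted suffix of \<open>g\<close> of
  length at least \<open>m\<close>; \<open>cyl_le\<close> bounds its mass.\<close>

lemma u_cyl_approx:
  assumes g: "alternating g" and len: "length w + m \<le> length g" and m: "0 < m"
  shows "\<bar>u (cyl w) g - indicator {g. take (length w) g = w} g\<bar> \<le> c ^ (m div 2)"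
proof -
  let ?k = "length w"
  let ?bad = "{\<xi> \<in> boundary. stake ?k (act g \<xi>) \<noteq> take ?k g}"
  have "?bad \<subseteq> cyl (winv (drop ?k g))"
    using stake_act [OF g] len m by (auto simp: cyl_def)
  then have mono: "measure \<nu> Y \<le> measure \<nu> (cyl (winv (drop ?k g)))" if "Y \<subseteq> ?bad" for Y
    using that by (intro nu.finite_measure_mono) (auto simp: sets_nu sets_cyl)
  have le: "measure \<nu> (cyl (winv (drop ?k g))) \<le> c ^ (m div 2)"
  proof -
    have "measure \<nu> (cyl (winv (drop ?k g))) \<le> c ^ (length (winv (drop ?k g)) div 2)"
      by (rule cyl_le)
    also have "\<dots> \<le> c ^ (m div 2)"
      using c len by (intro power_decreasing) (auto intro: div_le_mono)
    finally show ?thesis .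
  qed
  have bad: "measure \<nu> Y \<le> c ^ (m div 2)" if "Y \<subseteq> ?bad" for Y
    using mono [OF that] le by (rule order_trans)
  let ?A = "act g -` cyl w \<inter> boundary"
  have A: "?A \<in> sets \<nu>"
    by (simp add: sets_nu sets_act_vimage sets_cyl)
  show ?thesis
  proof (cases "take ?k g = w")
    case True
    have "1 - u (cyl w) g = measure \<nu> (boundary - ?A)"
      using nu.prob_compl [OF A] by (simp add: u_def space_nu)
    also have "\<dots> \<le> c ^ (m div 2)"
      using True by (intro bad) (auto simp: cyl_def act_boundary)
    finally show ?thesis
      using True u_bounds [of "cyl w" g] by simp
  next
    case False
    have "u (cyl w) g \<le> c ^ (m div 2)"
      unfolding u_def using False by (intro bad) (auto simp: cyl_def)
    then show ?thesis
      using False u_bounds [of "cyl w" g] by simp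
  qed
qed

text \<open>By harmonicity \<open>measure \<nu> (cyl w)\<close> is the mean of
  \<open>u (cyl w)\<close> at every time \<open>n\<close>. On long words this function is nearly the
  indicator of having prefix \<open>w\<close>, and short words lose their probability by
  transience.\<close>

lemma prefix_prob_tendsto:
  "(\<lambda>n. measure S {\<omega>. take (length w) (rwalk [] \<omega> n) = w}) \<longlonglongrightarrow> measure \<nu> (cyl w)"
proof -
  let ?f = "indicator {g. take (length w) g = w} :: letter list \<Rightarrow> real"
  define B where "B m = {g :: letter list. alternating g \<and> length g < length w + m}" for m
  have "finite (B m)" for m
  proof -
    have "finite {w' :: letter list. set w' \<subseteq> UNIV \<and> length w' \<le> length w + m}"
      by (rule finite_lists_length_le) simp
    then show ?thesis
      by (rule rev_finite_subset) (auto simp: B_def)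
  qed
  note finB = this
  \<comment> \<open>\<open>t m n\<close> is the probability that at time \<open>n\<close> the walk
    is in \<open>B m\<close>, that is, too short for \<open>u_cyl_approx\<close>.\<close>
  define t where "t m n = (\<Sum>b\<in>B m. (mop \<mu> ^^ n) (indicator {b}) [])" for m n
  have t: "t m \<longlonglongrightarrow> 0" for m
  proof -
    have "(\<lambda>n. \<Sum>b\<in>B m. (mop \<mu> ^^ n) (indicator {b}) []) \<longlonglongrightarrow> (\<Sum>b\<in>B m. 0)"
      by (intro tendsto_sum summable_LIMSEQ_zero summable_funpow_mop) (auto simp: B_def)
    then show ?thesis by (simp add: t_def [abs_def])
  qed
  have bound: "\<bar>(mop \<mu> ^^ n) ?f [] - measure \<nu> (cyl w)\<bar> \<le> c ^ (m div 2) + t m n" if "0 < m" for m n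
  proof -
    \<comment> \<open>The second summand is 1 on \<open>B m\<close>, where only the trivial bound on
      the difference is available.\<close>
    let ?d = "\<lambda>g. c ^ (m div 2) + (\<Sum>b\<in>B m. indicator {b} g)"
    have d: "\<bar>u (cyl w) g - ?f g\<bar> \<le> ?d g" if "alternating g" for g
    proof (cases "g \<in> B m")
      case True
      then have "(\<Sum>b\<in>B m. indicator {b} g :: real) = 1"
        using finB by (simp add: indicator_def if_distrib [of of_bool] sum.If_cases)
      moreover have "\<bar>u (cyl w) g - ?f g\<bar> \<le> 1"
        using u_bounds [of "cyl w" g] by (auto split: split_indicator)
      moreover have "0 \<le> c ^ (m div 2)"
        using c by simp
      ultimately show ?thesis by linarith
    next
      case False
      have "0 \<le> (\<Sum>b\<in>B m. indicator {b} g :: real)"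
        by (intro sum_nonneg) auto
      moreover have "\<bar>u (cyl w) g - ?f g\<bar> \<le> c ^ (m div 2)"
        using False that \<open>0 < m\<close> by (intro u_cyl_approx) (auto simp: B_def)
      ultimately show ?thesis by linarith
    qed
    have Pd: "(mop \<mu> ^^ n) ?d [] = c ^ (m div 2) + t m n"
      by (simp add: funpow_mop_add funpow_mop_const funpow_mop_sum [OF finB] t_def)
    have Pu: "(mop \<mu> ^^ n) (u (cyl w)) [] = measure \<nu> (cyl w)"
      by (simp add: funpow_mop_u u_Nil sets_cyl)
    have "(mop \<mu> ^^ n) (u (cyl w)) [] \<le> (mop \<mu> ^^ n) (\<lambda>g. ?f g + ?d g) []"
      by (rule funpow_mop_mono) (use d in \<open>force simp: abs_le_iff\<close>)+
    moreover have "(mop \<mu> ^^ n) ?f [] \<le> (mop \<mu> ^^ n) (\<lambda>g. u (cyl w) g + ?d g) []"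
      by (rule funpow_mop_mono) (use d in \<open>force simp: abs_le_iff\<close>)+
    ultimately show ?thesis
      unfolding funpow_mop_add [of n _ ?d] Pd Pu by linarith
  qed
  have "(\<lambda>n. (mop \<mu> ^^ n) ?f []) \<longlonglongrightarrow> measure \<nu> (cyl w)"
  proof (rule LIMSEQ_I)
    fix e :: real assume "0 < e"
    then have "\<forall>\<^sub>F k in sequentially. c ^ k < e / 2"
      using c by (intro order_tendstoD(2) [OF LIMSEQ_power_zero]) auto
    then obtain k where k: "c ^ k < e / 2"
      by (auto simp: eventually_sequentially)
    \<comment> \<open>The value \<open>2 * Suc k\<close> for \<open>m\<close> is positive, as
      \<open>bound\<close> requires, and its half is \<open>Suc k\<close>.\<close>
    have m: "c ^ (2 * Suc k div 2) < e / 2"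
    proof -
      have "c * c ^ k \<le> 1 * c ^ k"
        using c by (intro mult_right_mono) auto
      with k show ?thesis by simp
    qed
    obtain N where N: "\<And>n. n \<ge> N \<Longrightarrow> t (2 * Suc k) n < e / 2"
      using order_tendstoD(2) [OF t, of "e / 2" "2 * Suc k"] \<open>0 < e\<close>
      by (auto simp: eventually_sequentially)
    show "\<exists>N. \<forall>n\<ge>N. norm ((mop \<mu> ^^ n) ?f [] - measure \<nu> (cyl w)) < e"
    proof (intro exI allI impI)
      fix n assume "n \<ge> N"
      then show "norm ((mop \<mu> ^^ n) ?f [] - measure \<nu> (cyl w)) < e"
        using bound [of "2 * Suc k" n] m N [of n] by simp
    qed
  qed
  then show ?thesis
    using measure_rwalk [of "[]" _ "{g. take (length w) g = w}"] by simp
qed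

text \<open>Almost surely the prefix of the walk is eventually that of the limit, so by dominated
  convergence the prefix probabilities tend to the harmonic measure of the cylinder; by
  \<open>prefix_prob_tendsto\<close> they also tend to its \<open>\<nu>\<close>-measure.\<close>

lemma harmonic_measure_eq: "harmonic_measure \<mu> = \<nu>"
proof (rule boundary_measure_eqI)
  show "prob_space (harmonic_measure \<mu>)"
    unfolding harmonic_measure_def by (rule S.prob_space_distr) measurable
  interpret H: prob_space "harmonic_measure \<mu>" by fact
  show "sets (harmonic_measure \<mu>) = sets boundary_space"
    by (simp add: harmonic_measure_def)
  fix w
  let ?A = "\<lambda>n. {\<omega>. take (length w) (rwalk [] \<omega> n) = w}"
  let ?L = "limit_point -` cyl w \<inter> space S"
  have A: "?A n \<in> sets S" for n
    using measurable_sets [OF measurable_rwalk, of "{g. take (length w) g = w}" "[]" n]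
    by (simp add: vimage_def)
  have L: "?L \<in> sets S"
    by (rule measurable_sets [OF measurable_limit_point sets_cyl])
  have "(\<lambda>n. \<integral>\<omega>. indicator (?A n) \<omega> \<partial>S) \<longlonglongrightarrow> (\<integral>\<omega>. indicator ?L \<omega> \<partial>S :: real)"
  proof (rule integral_dominated_convergence [where w = "\<lambda>_. 1"])
    show "AE \<omega> in S. (\<lambda>n. indicator (?A n) \<omega> :: real) \<longlonglongrightarrow> indicator ?L \<omega>"
      using AE_converges
    proof eventually_elim
      case (elim \<omega>)
      then have "\<forall>\<^sub>F n in sequentially. take (length w) (rwalk [] \<omega> n) = stake (length w) (limit_point \<omega>)"
        by (simp add: converges_to_def)
      then have "\<forall>\<^sub>F n in sequentially. indicator (?A n) \<omega> = (indicator ?L \<omega> :: real)"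
        by (rule eventually_mono) (use elim in \<open>auto simp: cyl_def split: split_indicator\<close>)
      then show ?case
        by (rule tendsto_eventually)
    qed
  qed (use A L in auto)
  then have "(\<lambda>n. measure S (?A n)) \<longlonglongrightarrow> measure S ?L"
    by simp
  then have "measure S ?L = measure \<nu> (cyl w)"
    using prefix_prob_tendsto [of w] by (rule LIMSEQ_unique)
  moreover have "measure (harmonic_measure \<mu>) (cyl w) = measure S ?L"
    unfolding harmonic_measure_def by (rule measure_distr) (simp_all add: sets_cyl)
  ultimately show "emeasure (harmonic_measure \<mu>) (cyl w) = emeasure \<nu> (cyl w)"
    by (simp add: H.emeasure_eq_measure nu.emeasure_eq_measure)
qed (fact prob_space_nu sets_nu)+

end

section \<open>Distinct Denjoy classes are mutually singular\<close>

text \<open>The likelihood of the first \<open>n\<close> tosses under the parameter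
  \<open>\<alpha>\<close>.\<close>

primrec lik :: "real \<Rightarrow> nat \<Rightarrow> bool stream \<Rightarrow> real" where
  "lik \<alpha> 0 \<beta> = 1"
| "lik \<alpha> (Suc n) \<beta> = (if shd \<beta> then \<alpha> else 1 - \<alpha>) * lik \<alpha> n (stl \<beta>)"

lemma measurable_lik [measurable]: "lik \<alpha> n \<in> borel_measurable (coin \<gamma>)"
proof (induction n)
  case (Suc n)
  note Suc [measurable]
  have [measurable]: "shd \<in> coin \<gamma> \<rightarrow>\<^sub>M count_space UNIV"
    using measurable_shd [of "measure_pmf (bernoulli_pmf \<gamma>)"] by simp
  show ?case by simp
qed simp

lemma sets_lik_le: "{\<beta>. lik \<alpha> n \<beta> \<le> r * lik \<theta> n \<beta>} \<in> sets (coin \<gamma>)"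
proof -
  have "{\<beta> \<in> space (coin \<gamma>). lik \<alpha> n \<beta> \<le> r * lik \<theta> n \<beta>} \<in> sets (coin \<gamma>)"
    by measurable
  then show ?thesis by simp
qed

text \<open>The general threshold \<open>r\<close> is needed for the induction on \<open>n\<close>.\<close>

lemma measure_lik_le:
  assumes \<alpha>: "0 < \<alpha>" "\<alpha> < 1" and \<theta>: "0 < \<theta>" "\<theta> < 1" and "0 < r"
  shows "measure (coin \<alpha>) {\<beta>. lik \<alpha> n \<beta> \<le> r * lik \<theta> n \<beta>}
    \<le> sqrt r * (sqrt (\<alpha> * \<theta>) + sqrt ((1 - \<alpha>) * (1 - \<theta>))) ^ n"
  using \<open>0 < r\<close>
proof (induction n arbitrary: r)
  case 0
  interpret prob_space "coin \<alpha>" by (rule prob_space_coin)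
  show ?case
    using 0 prob_le_1 [of UNIV] by (cases "1 \<le> r") (auto intro: order_trans)
next
  case (Suc n)
  \<comment> \<open>The Hellinger affinity of the two toss laws.\<close>
  let ?\<rho> = "sqrt (\<alpha> * \<theta>) + sqrt ((1 - \<alpha>) * (1 - \<theta>))"
  let ?M = "measure (coin \<alpha>)"
  have eq: "s * sqrt (r * t / s) = sqrt r * sqrt (s * t)" if "0 < s" "0 < t" for s t :: real
    using that Suc.prems by (simp add: real_sqrt_mult real_sqrt_divide field_simps)
  \<comment> \<open>After the first toss the inequality keeps its form, with \<open>r\<close>
    rescaled by the likelihood ratio of that toss.\<close>
  have "?M {\<beta>. lik \<alpha> (Suc n) \<beta> \<le> r * lik \<theta> (Suc n) \<beta>} =
    \<alpha> * ?M {\<beta>. lik \<alpha> n \<beta> \<le> r * \<theta> / \<alpha> * lik \<theta> n \<beta>} +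
    (1 - \<alpha>) * ?M {\<beta>. lik \<alpha> n \<beta> \<le> r * (1 - \<theta>) / (1 - \<alpha>) * lik \<theta> n \<beta>}"
    using measure_coin_rec [OF sets_lik_le \<alpha>, of \<alpha> "Suc n" r \<theta>] \<alpha>
    by (simp add: field_simps)
  also have "\<dots> \<le> \<alpha> * (sqrt (r * \<theta> / \<alpha>) * ?\<rho> ^ n) + (1 - \<alpha>) * (sqrt (r * (1 - \<theta>) / (1 - \<alpha>)) * ?\<rho> ^ n)"
    using \<alpha> \<theta> Suc.prems by (intro add_mono mult_left_mono Suc.IH) auto
  also have "\<dots> = (\<alpha> * sqrt (r * \<theta> / \<alpha>) + (1 - \<alpha>) * sqrt (r * (1 - \<theta>) / (1 - \<alpha>))) * ?\<rho> ^ n"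
    by (simp add: algebra_simps)
  also have "\<dots> = sqrt r * ?\<rho> ^ Suc n"
    using \<alpha> \<theta> by (subst (1 2) eq) (auto simp: algebra_simps)
  finally show ?case .
qed

text \<open>Arithmetic-geometric mean inequality for both summands, strict for the first because the
  parameters differ.\<close>

lemma hellinger_less_1:
  assumes \<alpha>: "0 < \<alpha>" "\<alpha> < 1" and \<theta>: "0 < \<theta>" "\<theta> < 1" and "\<alpha> \<noteq> \<theta>"
  shows "sqrt (\<alpha> * \<theta>) + sqrt ((1 - \<alpha>) * (1 - \<theta>)) < 1"
proof -
  have am: "2 * sqrt (x * y) = x + y - (sqrt x - sqrt y)\<^sup>2" if "0 < x" "0 < y" for x y :: real
    using that by (simp add: power2_diff real_sqrt_mult)
  have "sqrt \<alpha> \<noteq> sqrt \<theta>"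
    using assms by simp
  then have "0 < (sqrt \<alpha> - sqrt \<theta>)\<^sup>2"
    by simp
  moreover have "0 \<le> (sqrt (1 - \<alpha>) - sqrt (1 - \<theta>))\<^sup>2"
    by simp
  ultimately have "2 * sqrt (\<alpha> * \<theta>) + 2 * sqrt ((1 - \<alpha>) * (1 - \<theta>)) < 2"
    using am [of \<alpha> \<theta>] am [of "1 - \<alpha>" "1 - \<theta>"] assms by linarith
  then show ?thesis by simp
qed

text \<open>Borel-Cantelli: by \<open>measure_lik_le\<close> with \<open>r = 1\<close>, the
  probability that the wrong parameter is at least as likely decays geometrically.\<close>

lemma AE_coin_lik_less:
  assumes \<alpha>: "0 < \<alpha>" "\<alpha> < 1" and \<theta>: "0 < \<theta>" "\<theta> < 1" and "\<alpha> \<noteq> \<theta>"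
  shows "AE \<beta> in coin \<alpha>. \<forall>\<^sub>F n in sequentially. lik \<theta> n \<beta> < lik \<alpha> n \<beta>"
proof -
  interpret prob_space "coin \<alpha>" by (rule prob_space_coin)
  let ?\<rho> = "sqrt (\<alpha> * \<theta>) + sqrt ((1 - \<alpha>) * (1 - \<theta>))"
  have "0 \<le> ?\<rho>"
    using assms by simp
  with hellinger_less_1 [OF assms] have "summable (\<lambda>n. ?\<rho> ^ n)"
    by (intro summable_geometric) auto
  then have "summable (\<lambda>n. measure (coin \<alpha>) {\<beta>. lik \<alpha> n \<beta> \<le> lik \<theta> n \<beta>})"
    by (rule summable_comparison_test') (use measure_lik_le [OF \<alpha> \<theta>, of 1] in simp)
  then have "AE \<beta> in coin \<alpha>. \<forall>\<^sub>F n in sequentially. \<beta> \<in> space (coin \<alpha>) - {\<beta>. lik \<alpha> n \<beta> \<le> lik \<theta> n \<beta>}"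
    using sets_lik_le [of \<alpha> _ 1 \<theta> \<alpha>]
    by (intro borel_cantelli_AE1) (auto simp: emeasure_eq_measure)
  then show ?thesis
    by (simp add: not_le)
qed

text \<open>The separating event is that \<open>\<theta>\<close> eventually has the larger
  likelihood.\<close>

lemma coin_singular:
  assumes \<alpha>: "0 < \<alpha>" "\<alpha> < 1" and \<theta>: "0 < \<theta>" "\<theta> < 1" and "\<alpha> \<noteq> \<theta>"
  obtains E where "\<And>\<gamma>. E \<in> sets (coin \<gamma>)" "measure (coin \<alpha>) E = 0" "measure (coin \<theta>) E = 1"
proof
  let ?E = "{\<beta>. \<forall>\<^sub>F n in sequentially. lik \<alpha> n \<beta> < lik \<theta> n \<beta>}"
  show sets: "?E \<in> sets (coin \<gamma>)" for \<gamma>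
  proof -
    have "{\<beta> \<in> space (coin \<gamma>). \<forall>\<^sub>F n in sequentially. lik \<alpha> n \<beta> < lik \<theta> n \<beta>} \<in> sets (coin \<gamma>)"
      unfolding eventually_sequentially by measurable
    then show ?thesis by simp
  qed
  have "AE \<beta> in coin \<alpha>. \<beta> \<notin> ?E"
    using AE_coin_lik_less [OF assms]
  proof eventually_elim
    case (elim \<beta>)
    show ?case
    proof
      assume "\<beta> \<in> ?E"
      with elim have "\<forall>\<^sub>F n in sequentially. lik \<theta> n \<beta> < lik \<alpha> n \<beta> \<and> lik \<alpha> n \<beta> < lik \<theta> n \<beta>"
        by (simp add: eventually_conj)
      then show False
        by (auto simp: eventually_sequentially)
    qed
  qed
  then have "?E \<in> null_sets (coin \<alpha>)"
    using sets by (simp add: AE_iff_null_sets)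
  then show "measure (coin \<alpha>) ?E = 0"
    by (rule measure_eq_0_null_sets)
  interpret prob_space "coin \<theta>" by (rule prob_space_coin)
  show "measure (coin \<theta>) ?E = 1"
    using AE_coin_lik_less [OF \<theta> \<alpha>] \<open>\<alpha> \<noteq> \<theta>\<close> sets by (subst prob_eq_1) auto
qed

section \<open>Null sets of the mixtures\<close>

text \<open>The criterion does not involve \<open>p\<close>, so all mixtures with the same
  \<open>\<alpha>\<close> are equivalent.\<close>

lemma null_sets_kappa_mix:
  assumes "0 < p" "p < 1"
  shows "X \<in> null_sets (kappa_mix \<alpha> p) \<longleftrightarrow> X \<in> sets boundary_space \<and> kact \<alpha> X [] = 0 \<and> kact \<alpha> X [La] = 0"
proof -
  have "ennreal (p * kact \<alpha> X [] + (1 - p) * kact \<alpha> X [La]) = 0 \<longleftrightarrow>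
      kact \<alpha> X [] = 0 \<and> kact \<alpha> X [La] = 0"
  proof -
    have "0 \<le> p * kact \<alpha> X []" "0 \<le> (1 - p) * kact \<alpha> X [La]"
      using assms kact_nonneg by auto
    then have "p * kact \<alpha> X [] + (1 - p) * kact \<alpha> X [La] \<le> 0 \<longleftrightarrow>
        p * kact \<alpha> X [] = 0 \<and> (1 - p) * kact \<alpha> X [La] = 0"
      by linarith
    then show ?thesis
      using assms by (simp add: ennreal_eq_0_iff)
  qed
  then show ?thesis
    using assms by (auto simp: null_sets_def emeasure_kappa_mix_kact)
qed

lemma kappa_mix_in_denjoy_class:
  "0 < p \<Longrightarrow> p < 1 \<Longrightarrow> kappa_mix \<alpha> p \<in> denjoy_class \<alpha>"
  by (auto simp: denjoy_class_def equivalent_measures_def absolutely_continuous_def null_sets_kappa_mix)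

text \<open>For distinct parameters, a separating event for the tosses is transported to the
  boundary by decoding words into tosses.\<close>

lemma kappa_mix_absolutely_continuous_imp_eq:
  assumes \<alpha>: "0 < \<alpha>" "\<alpha> < 1" and \<theta>: "0 < \<theta>" "\<theta> < 1"
    and p: "0 < p" "p < 1" and q: "0 < q" "q < 1"
    and ac: "absolutely_continuous (kappa_mix \<alpha> q) (kappa_mix \<theta> p)"
  shows "\<alpha> = \<theta>"
proof (rule ccontr)
  assume "\<alpha> \<noteq> \<theta>"
  then obtain E where E: "\<And>\<gamma>. E \<in> sets (coin \<gamma>)" "measure (coin \<alpha>) E = 0" "measure (coin \<theta>) E = 1"
    using coin_singular [OF \<alpha> \<theta>] by blast
  \<comment> \<open>The tosses of a coin word sit at its odd indices.\<close>
  define dec where "dec \<xi> = to_stream (\<lambda>i. \<xi> !! (2 * i + 1) = Lb)" for \<xi>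
  have dec_coin_word: "dec (coin_word \<beta>) = \<beta>" for \<beta>
  proof -
    have "dec (coin_word \<beta>) !! n = \<beta> !! n" for n
      by (simp add: dec_def to_stream_def coin_word_snth del: snth.simps)
    then show ?thesis
      using smap_alt [of id "dec (coin_word \<beta>)" \<beta>] by (simp add: stream.map_id)
  qed
  have snth: "(\<lambda>\<xi>. \<xi> !! n) \<in> boundary_space \<rightarrow>\<^sub>M count_space UNIV" for n
    by (intro measurable_from_boundary_space measurable_snth)
  have dec: "dec \<in> boundary_space \<rightarrow>\<^sub>M coin \<alpha>"
  proof (rule measurable_stream_space2)
    fix n
    have "(\<lambda>\<xi>. \<xi> !! (2 * n + 1) = Lb) \<in> boundary_space \<rightarrow>\<^sub>M count_space UNIV"
      by (rule measurable_compose [OF snth]) simp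
    then show "(\<lambda>\<xi>. dec \<xi> !! n) \<in> boundary_space \<rightarrow>\<^sub>M measure_pmf (bernoulli_pmf \<alpha>)"
      by (simp add: dec_def to_stream_def measurable_pmf_measure2 del: snth.simps)
  qed
  \<comment> \<open>Intersecting with \<open>cyl [La]\<close> removes the component translated by
    \<open>[La]\<close>, whose words do not begin with \<open>La\<close>.\<close>
  define X where "X = dec -` E \<inter> cyl [La]"
  have "dec -` E \<inter> space boundary_space \<in> sets boundary_space"
    using dec E(1) by (rule measurable_sets)
  then have "dec -` E \<inter> space boundary_space \<inter> cyl [La] \<in> sets boundary_space"
    using sets_cyl by (rule sets.Int)
  also have "dec -` E \<inter> space boundary_space \<inter> cyl [La] = X"
    by (auto simp: X_def cyl_def)
  finally have X: "X \<in> sets boundary_space" .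
  have 1: "kact \<gamma> X [] = measure (coin \<gamma>) E" for \<gamma>
    by (simp add: kact_def X_def dec_coin_word cyl_def coin_word_boundary)
  have "shd (stl (coin_word \<beta>)) \<noteq> La" for \<beta>
    by (cases \<beta>) (simp add: coin_word_SCons)
  then have 2: "kact \<gamma> X [La] = 0" for \<gamma>
    by (simp add: kact_def X_def cyl_def push_stream_def)
  have "X \<in> null_sets (kappa_mix \<alpha> q)"
    using X E(2) by (simp add: null_sets_kappa_mix q 1 2)
  then have "X \<in> null_sets (kappa_mix \<theta> p)"
    using ac by (auto simp: absolutely_continuous_def)
  then show False
    using E(3) by (simp add: null_sets_kappa_mix p 1)
qed

section \<open>The stationarity equations\<close>

definition steps :: "letter list set" where
  "steps = {[La], [Lb], [Lbi], [Lb, La], [Lbi, La]}"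

lemma sum_steps:
  "(\<Sum>h\<in>steps. f h) = f [La] + f [Lb] + f [Lbi] + f [Lb, La] + (f [Lbi, La] :: real)"
  by (simp add: steps_def)

lemma sum_pmf_steps:
  assumes "set_pmf \<mu> \<subseteq> steps"
  shows "(\<Sum>h\<in>set_pmf \<mu>. pmf \<mu> h * f h) = (\<Sum>h\<in>steps. pmf \<mu> h * f h)"
  using assms by (intro sum.mono_neutral_left) (auto simp: steps_def set_pmf_iff)

lemma kact_vimage:
  "kact \<alpha> (act h -` X \<inter> boundary) g = kact \<alpha> X (h @ g)"
  by (simp add: kact_def act_append act_boundary coin_word_boundary)

text \<open>Every translate involved is a combination of those by \<open>[]\<close>,
  \<open>[Lb]\<close> and \<open>[Lbi]\<close>. The hypotheses \<open>eq_b\<close> and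
  \<open>eq_bi\<close> equate the coefficients at \<open>[Lb]\<close> and \<open>[Lbi]\<close>; the
  one at \<open>[]\<close> then agrees because total masses do.\<close>

lemma stationary_kappa_mix:
  assumes supp: "set_pmf \<mu> \<subseteq> steps"
    and \<theta>: "0 < \<theta>" "\<theta> < 1" and p: "0 < p" "p < 1"
    and eq_b: "(1 - p) * (\<theta> - pmf \<mu> [Lbi] * (1 - \<theta>) - pmf \<mu> [Lb, La]) =
      p * (pmf \<mu> [La] * \<theta> + pmf \<mu> [Lbi, La] * (1 - \<theta>) + pmf \<mu> [Lb])"
    and eq_bi: "(1 - p) * ((1 - \<theta>) - pmf \<mu> [Lb] * \<theta> - pmf \<mu> [Lbi, La]) =
      p * (pmf \<mu> [La] * (1 - \<theta>) + pmf \<mu> [Lb, La] * \<theta> + pmf \<mu> [Lbi])"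
    and X: "X \<in> sets boundary_space"
  shows "measure (kappa_mix \<theta> p) X =
    (\<Sum>h\<in>set_pmf \<mu>. pmf \<mu> h * measure (kappa_mix \<theta> p) (act h -` X \<inter> boundary))"
proof -
  let ?k = "kact \<theta> X"
  let ?wa = "pmf \<mu> [La]" and ?wb = "pmf \<mu> [Lb]" and ?wbi = "pmf \<mu> [Lbi]"
    and ?wb' = "pmf \<mu> [Lb, La]" and ?wbi' = "pmf \<mu> [Lbi, La]"
  have Y: "act h -` X \<inter> boundary \<in> sets boundary_space" for h
    using measurable_sets [OF measurable_act X, of h] by simp
  have m: "measure (kappa_mix \<theta> p) (act h -` X \<inter> boundary) = p * ?k h + (1 - p) * ?k (h @ [La])" for h
    using measure_kappa_mix [OF Y p, of \<theta> h] by (simp add: kact_vimage)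
  have total: "?wa + ?wb + ?wbi + ?wb' + ?wbi' = 1"
    using sum_pmf_eq_1 [of steps \<mu>] supp by (simp add: sum_steps) (simp add: steps_def)
  have red: "?k (x # y # v) = ?k (letter_pair x y @ v)" "?k (z # x # y # v) = ?k (z # letter_pair x y @ v)" for x y z v
    using kact_reduce [of \<theta> X "[]" x y v] kact_reduce [of \<theta> X "[z]" x y v] by simp_all
  note split = kact_split [OF X \<theta>]
  \<comment> \<open>Splitting off the first toss creates \<open>La, La\<close>, which cancels; this
    eliminates the translates ending in \<open>La\<close>.\<close>
  have ka: "?k [La] = \<theta> * ?k [Lb] + (1 - \<theta>) * ?k [Lbi]"
    using split [of "[La]"] red(1) [of La La "[Lb]"] red(1) [of La La "[Lbi]"] by simp
  have kba: "?k [Lb, La] = \<theta> * ?k [Lbi] + (1 - \<theta>) * ?k []"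
    using split [of "[Lb, La]"] red(2) [of Lb La La "[Lb]"] red(2) [of Lb La La "[Lbi]"]
      red(1) [of Lb Lb "[]"] red(1) [of Lb Lbi "[]"] by simp
  have kbia: "?k [Lbi, La] = \<theta> * ?k [] + (1 - \<theta>) * ?k [Lb]"
    using split [of "[Lbi, La]"] red(2) [of Lbi La La "[Lb]"] red(2) [of Lbi La La "[Lbi]"]
      red(1) [of Lbi Lb "[]"] red(1) [of Lbi Lbi "[]"] by simp
  have kaa: "?k [La, La] = ?k []" "?k [Lb, La, La] = ?k [Lb]" "?k [Lbi, La, La] = ?k [Lbi]"
    using red(1) [of La La "[]"] red(2) [of Lb La La "[]"] red(2) [of Lbi La La "[]"] by simp_all
  \<comment> \<open>The coefficient at \<open>[]\<close>, obtained from the other two and the total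
    mass of \<open>\<mu>\<close>.\<close>
  have c1: "p = ?wa * (1 - p) + ?wb * (1 - p) * (1 - \<theta>) + ?wbi * (1 - p) * \<theta> + ?wb' * p * (1 - \<theta>) + ?wbi' * p * \<theta>"
  proof -
    have "p = p * (?wa + ?wb + ?wbi + ?wb' + ?wbi')"
      by (simp add: total)
    moreover have "(1 - p) * 1 = (1 - p) * (?wa + ?wb + ?wbi + ?wb' + ?wbi')"
      by (simp add: total)
    ultimately show ?thesis
      using eq_b eq_bi by (simp add: algebra_simps)
  qed
  have cb: "(1 - p) * \<theta> = ?wa * p * \<theta> + ?wb * p + ?wbi * (1 - p) * (1 - \<theta>) + ?wb' * (1 - p) + ?wbi' * p * (1 - \<theta>)"
    using eq_b by (simp add: algebra_simps)
  have cbi: "(1 - p) * (1 - \<theta>) = ?wa * p * (1 - \<theta>) + ?wbi * p + ?wb * (1 - p) * \<theta> + ?wb' * p * \<theta> + ?wbi' * (1 - p)"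
    using eq_bi by (simp add: algebra_simps)
  have "measure (kappa_mix \<theta> p) X = p * ?k [] + ((1 - p) * \<theta>) * ?k [Lb] + ((1 - p) * (1 - \<theta>)) * ?k [Lbi]"
    by (simp add: measure_kappa_mix [OF X p] ka algebra_simps)
  also have "\<dots> =
     ?wa * (p * ?k [La] + (1 - p) * ?k [La, La]) + ?wb * (p * ?k [Lb] + (1 - p) * ?k [Lb, La]) +
     ?wbi * (p * ?k [Lbi] + (1 - p) * ?k [Lbi, La]) + ?wb' * (p * ?k [Lb, La] + (1 - p) * ?k [Lb, La, La]) +
     ?wbi' * (p * ?k [Lbi, La] + (1 - p) * ?k [Lbi, La, La])"
    unfolding cb cbi by (subst c1) (simp add: ka kba kbia kaa algebra_simps)
  also have "\<dots> = (\<Sum>h\<in>set_pmf \<mu>. pmf \<mu> h * measure (kappa_mix \<theta> p) (act h -` X \<inter> boundary))"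
    unfolding sum_pmf_steps [OF supp] sum_steps m by simp
  finally show ?thesis .
qed

text \<open>The words beginning with \<open>La\<close> have mass \<open>p\<close>, but mass
  \<open>1 - p\<close> after translation by \<open>[La]\<close> and
  \<open>(1 - p) * (1 - \<theta>)\<close> after translation by \<open>[Lb]\<close>; these three
  cannot coincide.\<close>

lemma kappa_mix_not_invariant:
  assumes \<theta>: "0 < \<theta>" "\<theta> < 1" and p: "0 < p" "p < 1"
  shows "\<exists>g\<in>carrier Gamma. \<exists>X\<in>sets boundary_space.
    measure (kappa_mix \<theta> p) (act g -` X \<inter> boundary) \<noteq> measure (kappa_mix \<theta> p) X"
proof (rule ccontr)
  assume "\<not> ?thesis"
  then have inv: "measure (kappa_mix \<theta> p) (act [x] -` cyl [La] \<inter> boundary) = measure (kappa_mix \<theta> p) (cyl [La])" for x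
    by (auto simp: carrier_Gamma sets_cyl)
  let ?k = "kact \<theta> (cyl [La])"
  interpret prob_space "coin \<theta>" by (rule prob_space_coin)
  have k1: "?k [] = 1"
    using prob_space by (simp add: kact_def cyl_def coin_word_boundary)
  have "shd (stl (coin_word \<beta>)) \<noteq> La" for \<beta>
    by (cases \<beta>) (simp add: coin_word_SCons)
  then have ka: "?k [La] = 0"
    by (simp add: kact_def cyl_def push_stream_def)
  have kb: "?k [Lb] = 0" "?k [Lbi] = 0"
    by (simp_all add: kact_def cyl_def)
  have "?k [La, La] = 1" "?k [Lb, La, La, Lb] = 0" "?k [Lb, La, La, Lbi] = 1"
    using kact_reduce [of \<theta> "cyl [La]" "[]" La La "[]"]
      kact_reduce [of \<theta> "cyl [La]" "[Lb]" La La "[Lb]"] kact_reduce [of \<theta> "cyl [La]" "[]" Lb Lb "[]"]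
      kact_reduce [of \<theta> "cyl [La]" "[Lb]" La La "[Lbi]"] kact_reduce [of \<theta> "cyl [La]" "[]" Lb Lbi "[]"]
    by (simp_all add: k1 kb)
  moreover from this have "?k [Lb, La] = 1 - \<theta>"
    using kact_split [OF sets_cyl \<theta>, of "[La]" "[Lb, La]"] by simp
  moreover have "measure (kappa_mix \<theta> p) (act h -` cyl [La] \<inter> boundary) = p * ?k h + (1 - p) * ?k (h @ [La])" for h
    using measure_kappa_mix [OF _ p, of "act h -` cyl [La] \<inter> boundary" \<theta>]
      measurable_sets [OF measurable_act sets_cyl, of h "[La]"]
    by (simp add: kact_vimage)
  moreover have "measure (kappa_mix \<theta> p) (cyl [La]) = p"
    using measure_kappa_mix [OF sets_cyl p] k1 ka by simp
  ultimately have "1 - p = p" "(1 - p) * (1 - \<theta>) = p"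
    using inv [of La] inv [of Lb] ka kb by simp_all
  then have "p * (1 - \<theta>) = p"
    by (simp only:)
  then show False
    using \<theta> p by simp
qed

lemma harmonic_measure_eq_kappa_mix:
  assumes "nondegenerate \<mu>" "set_pmf \<mu> \<subseteq> steps"
    and \<theta>: "0 < \<theta>" "\<theta> < 1" and p: "0 < p" "p < 1"
    and "(1 - p) * (\<theta> - pmf \<mu> [Lbi] * (1 - \<theta>) - pmf \<mu> [Lb, La]) =
      p * (pmf \<mu> [La] * \<theta> + pmf \<mu> [Lbi, La] * (1 - \<theta>) + pmf \<mu> [Lb])"
    and "(1 - p) * ((1 - \<theta>) - pmf \<mu> [Lb] * \<theta> - pmf \<mu> [Lbi, La]) =
      p * (pmf \<mu> [La] * (1 - \<theta>) + pmf \<mu> [Lb, La] * \<theta> + pmf \<mu> [Lbi])"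
  shows "harmonic_measure \<mu> = kappa_mix \<theta> p"
proof -
  interpret stationary_walk \<mu> "kappa_mix \<theta> p" "max \<theta> (1 - \<theta>)"
  proof (rule stationary_walk.intro)
    show "finite (set_pmf \<mu>)"
      using assms(2) by (rule finite_subset) (simp add: steps_def)
    show "prob_space (kappa_mix \<theta> p)"
      using p by (rule prob_space_kappa_mix)
    show "measure (kappa_mix \<theta> p) X =
        (\<Sum>h\<in>set_pmf \<mu>. pmf \<mu> h * measure (kappa_mix \<theta> p) (act h -` X \<inter> boundary))"
      if "X \<in> sets boundary_space" for X
      using assms that by (intro stationary_kappa_mix) auto
  qed (use assms in \<open>simp_all add: kappa_mix_cyl_le kappa_mix_not_invariant\<close>)
  show ?thesis
    by (rule harmonic_measure_eq)
qed

text \<open>The semigroup generated by \<open>{ba, b\<^sup>-\<^sup>1a}\<close> is free and consists of words ending in \<open>a\<close>.\<close>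

lemma nondegenerate_a_b_bi_pos:
  assumes "nondegenerate \<mu>" "set_pmf \<mu> \<subseteq> steps"
  shows "0 < pmf \<mu> [La] + pmf \<mu> [Lb] + pmf \<mu> [Lbi]"
proof (rule ccontr)
  assume neg: "\<not> ?thesis"
  have "pmf \<mu> [La] = 0" "pmf \<mu> [Lb] = 0" "pmf \<mu> [Lbi] = 0"
    using neg pmf_nonneg [of \<mu> "[La]"] pmf_nonneg [of \<mu> "[Lb]"] pmf_nonneg [of \<mu> "[Lbi]"]
    by linarith+
  with assms(2) have supp: "set_pmf \<mu> \<subseteq> {[Lb, La], [Lbi, La]}"
    by (auto simp: steps_def set_pmf_iff)
  have "x \<noteq> [] \<and> alternating x \<and> hd x \<noteq> La \<and> last x = La"
    if "x \<in> semigroup_span Gamma (set_pmf \<mu>)" for x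
    using that
  proof (induction rule: semigroup_span.induct)
    case (mult x y)
    then have "x \<cdot> y = x @ y"
      by (intro mult_eq_append) (simp add: alternating_append)
    with mult show ?case
      by (auto simp: alternating_append)
  qed (use supp in auto)
  then have "[La] \<notin> semigroup_span Gamma (set_pmf \<mu>)"
    by force
  then show False
    using assms(1) by (simp add: nondegenerate_def carrier_Gamma)
qed

text \<open>The letter \<open>a\<close> alone generates only a group of order two.\<close>

lemma nondegenerate_not_only_a:
  assumes "nondegenerate \<mu>" "set_pmf \<mu> \<subseteq> steps"
  shows "0 < pmf \<mu> [Lb] + pmf \<mu> [Lbi] + pmf \<mu> [Lb, La] + pmf \<mu> [Lbi, La]"
proof (rule ccontr)
  assume neg: "\<not> ?thesis"
  have "pmf \<mu> [Lb] = 0" "pmf \<mu> [Lbi] = 0" "pmf \<mu> [Lb, La] = 0" "pmf \<mu> [Lbi, La] = 0"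
    using neg pmf_nonneg [of \<mu> "[Lb]"] pmf_nonneg [of \<mu> "[Lbi]"]
      pmf_nonneg [of \<mu> "[Lb, La]"] pmf_nonneg [of \<mu> "[Lbi, La]"]
    by linarith+
  with assms(2) have supp: "set_pmf \<mu> \<subseteq> {[La]}"
    by (auto simp: steps_def set_pmf_iff)
  have "x = [] \<or> x = [La]" if "x \<in> semigroup_span Gamma (set_pmf \<mu>)" for x
    using that by (induction rule: semigroup_span.induct) (use supp in auto)
  then have "[Lb] \<notin> semigroup_span Gamma (set_pmf \<mu>)"
    by blast
  then show False
    using assms(1) by (simp add: nondegenerate_def carrier_Gamma)
qed

section \<open>Solving the stationarity equations\<close>

text \<open>Up to sign, the determinant of the two equations of \<open>stationary_kappa_mix\<close>,
  which are linear and homogeneous in \<open>1 - p\<close> and \<open>p\<close>.\<close>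

definition denjoy_defect :: "letter list pmf \<Rightarrow> real \<Rightarrow> real" where
  "denjoy_defect \<mu> \<theta> =
     (\<theta> - pmf \<mu> [Lbi] * (1 - \<theta>) - pmf \<mu> [Lb, La]) *
       (pmf \<mu> [La] * (1 - \<theta>) + pmf \<mu> [Lb, La] * \<theta> + pmf \<mu> [Lbi])
   - (pmf \<mu> [La] * \<theta> + pmf \<mu> [Lbi, La] * (1 - \<theta>) + pmf \<mu> [Lb]) *
       ((1 - \<theta>) - pmf \<mu> [Lb] * \<theta> - pmf \<mu> [Lbi, La])"

lemma harmonic_measure_if_defect_0:
  assumes nd: "nondegenerate \<mu>" and supp: "set_pmf \<mu> \<subseteq> steps"
    and \<theta>: "0 < \<theta>" "\<theta> < 1" and defect: "denjoy_defect \<mu> \<theta> = 0"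
  obtains p where "0 < p" "p < 1" "harmonic_measure \<mu> = kappa_mix \<theta> p"
proof -
  let ?wa = "pmf \<mu> [La]" and ?wb = "pmf \<mu> [Lb]" and ?wbi = "pmf \<mu> [Lbi]"
    and ?wb' = "pmf \<mu> [Lb, La]" and ?wbi' = "pmf \<mu> [Lbi, La]"
  define A1 A2 B1 B2 where "A1 = \<theta> - ?wbi * (1 - \<theta>) - ?wb'"
    and "A2 = (1 - \<theta>) - ?wb * \<theta> - ?wbi'"
    and "B1 = ?wa * \<theta> + ?wbi' * (1 - \<theta>) + ?wb"
    and "B2 = ?wa * (1 - \<theta>) + ?wb' * \<theta> + ?wbi"
  have total: "?wa + ?wb + ?wbi + ?wb' + ?wbi' = 1"
    using sum_pmf_eq_1 [of steps \<mu>] supp by (simp add: sum_steps) (simp add: steps_def)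
  have pos: "0 < ?wa + ?wb + ?wbi"
    using nd supp by (rule nondegenerate_a_b_bi_pos)
  have cross: "A1 * B2 = B1 * A2"
    using defect by (simp add: denjoy_defect_def A1_def A2_def B1_def B2_def)
  have A: "0 < A1 + A2"
  proof -
    \<comment> \<open>Total mass one turns the differences into a combination of weights with
      positive coefficients.\<close>
    have "A1 + A2 = ?wa + ?wb * (1 - \<theta>) + ?wbi * \<theta>"
      using total by (simp add: A1_def A2_def algebra_simps)
    moreover have "min \<theta> (1 - \<theta>) * (?wa + ?wb + ?wbi) \<le> ?wa + ?wb * (1 - \<theta>) + ?wbi * \<theta>"
    proof -
      have "min \<theta> (1 - \<theta>) * ?wa \<le> 1 * ?wa" "min \<theta> (1 - \<theta>) * ?wb \<le> (1 - \<theta>) * ?wb"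
        "min \<theta> (1 - \<theta>) * ?wbi \<le> \<theta> * ?wbi"
        using \<theta> by (intro mult_right_mono; simp)+
      then show ?thesis by (simp add: algebra_simps)
    qed
    moreover have "0 < min \<theta> (1 - \<theta>) * (?wa + ?wb + ?wbi)"
      using \<theta> pos by simp
    ultimately show ?thesis by linarith
  qed
  have B: "0 < B1 + B2"
  proof -
    have "B1 + B2 = ?wa + ?wb + ?wbi + ?wb' * \<theta> + ?wbi' * (1 - \<theta>)"
      by (simp add: B1_def B2_def algebra_simps)
    moreover have "0 \<le> ?wb' * \<theta>" "0 \<le> ?wbi' * (1 - \<theta>)"
      using \<theta> by auto
    ultimately show ?thesis using pos by linarith
  qed
  \<comment> \<open>Solves the sum of the two equations,
    \<open>(1 - p) * (A1 + A2) = p * (B1 + B2)\<close>; by \<open>cross\<close> it then solves each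
    of them.\<close>
  define p where "p = (A1 + A2) / (A1 + A2 + (B1 + B2))"
  have p1: "1 - p = (B1 + B2) / (A1 + A2 + (B1 + B2))"
    using A B by (simp add: p_def field_simps)
  have p: "0 < p" "p < 1"
    using A B by (simp_all add: p_def)
  have "(B1 + B2) * A1 = (A1 + A2) * B1" "(B1 + B2) * A2 = (A1 + A2) * B2"
    using cross by (simp_all add: algebra_simps)
  then have "(1 - p) * A1 = p * B1" "(1 - p) * A2 = p * B2"
    unfolding p1 unfolding p_def by simp_all
  then have "harmonic_measure \<mu> = kappa_mix \<theta> p"
    using harmonic_measure_eq_kappa_mix [OF nd supp \<theta> p]
    by (simp add: A1_def A2_def B1_def B2_def)
  with p show thesis by (rule that)
qed

text \<open>The defect is negative at 0 and positive at 1, so the intermediate value theorem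
  applies.\<close>

lemma defect_root:
  assumes nd: "nondegenerate \<mu>" and supp: "set_pmf \<mu> \<subseteq> steps"
  obtains \<theta> where "0 < \<theta>" "\<theta> < 1" "denjoy_defect \<mu> \<theta> = 0"
proof -
  let ?wa = "pmf \<mu> [La]" and ?wb = "pmf \<mu> [Lb]" and ?wbi = "pmf \<mu> [Lbi]"
    and ?wb' = "pmf \<mu> [Lb, La]" and ?wbi' = "pmf \<mu> [Lbi, La]"
  have total: "?wa + ?wb + ?wbi + ?wb' + ?wbi' = 1"
    using sum_pmf_eq_1 [of steps \<mu>] supp by (simp add: sum_steps) (simp add: steps_def)
  have pos: "0 < ?wa + ?wb + ?wbi" "0 < ?wb + ?wbi + ?wb' + ?wbi'"
    using nondegenerate_a_b_bi_pos [OF assms] nondegenerate_not_only_a [OF assms] by auto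
  have nn: "0 \<le> ?wa" "0 \<le> ?wb" "0 \<le> ?wbi" "0 \<le> ?wb'" "0 \<le> ?wbi'"
    by simp_all
  have sign: "0 < x * r + y * s" if "0 \<le> x" "0 \<le> y" "0 \<le> r" "0 < s" "0 < y \<or> 0 < x * r" for x y r s :: real
    using that by (auto intro: add_nonneg_pos add_pos_nonneg)
  \<comment> \<open>This is minus the defect at 0. If \<open>?wbi' + ?wb\<close> vanishes,
    \<open>pos\<close> makes both factors of the first product positive.\<close>
  have "0 < (?wbi + ?wb') * (?wa + ?wbi) + (?wbi' + ?wb) * (1 - ?wbi')"
  proof (rule sign)
    have "0 < ?wbi' + ?wb \<or> 0 < ?wbi + ?wb' \<and> 0 < ?wa + ?wbi"
      using pos nn by linarith
    then show "0 < ?wbi' + ?wb \<or> 0 < (?wbi + ?wb') * (?wa + ?wbi)"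
      by auto
  qed (use pos nn total in linarith)+
  then have 0: "denjoy_defect \<mu> 0 < 0"
    by (simp add: denjoy_defect_def algebra_simps)
  \<comment> \<open>The defect at 1, which mirrors the previous case under the exchange of
    \<open>Lb\<close> and \<open>Lbi\<close>.\<close>
  have "0 < (?wb + ?wbi') * (?wa + ?wb) + (?wb' + ?wbi) * (1 - ?wb')"
  proof (rule sign)
    have "0 < ?wb' + ?wbi \<or> 0 < ?wb + ?wbi' \<and> 0 < ?wa + ?wb"
      using pos nn by linarith
    then show "0 < ?wb' + ?wbi \<or> 0 < (?wb + ?wbi') * (?wa + ?wb)"
      by auto
  qed (use pos nn total in linarith)+
  then have 1: "0 < denjoy_defect \<mu> 1"
    by (simp add: denjoy_defect_def algebra_simps)
  have "continuous_on {0..1} (denjoy_defect \<mu>)"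
    unfolding denjoy_defect_def [abs_def] by (intro continuous_intros)
  with 0 1 obtain \<theta> where "0 \<le> \<theta>" "\<theta> \<le> 1" and \<theta>: "denjoy_defect \<mu> \<theta> = 0"
    using IVT' [of "denjoy_defect \<mu>" 0 0 1] by auto
  moreover have "\<theta> \<noteq> 0" "\<theta> \<noteq> 1"
    using 0 1 \<theta> by auto
  ultimately show thesis
    using that by (auto simp: less_le)
qed

lemma harmonic_measure_in_denjoy_class_iff:
  assumes nd: "nondegenerate \<mu>" and supp: "set_pmf \<mu> \<subseteq> steps"
    and \<alpha>: "0 < \<alpha>" "\<alpha> < 1"
  shows "harmonic_measure \<mu> \<in> denjoy_class \<alpha> \<longleftrightarrow> denjoy_defect \<mu> \<alpha> = 0"
proof
  assume "denjoy_defect \<mu> \<alpha> = 0"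
  then obtain p where "0 < p" "p < 1" "harmonic_measure \<mu> = kappa_mix \<alpha> p"
    by (rule harmonic_measure_if_defect_0 [OF nd supp \<alpha>])
  then show "harmonic_measure \<mu> \<in> denjoy_class \<alpha>"
    by (simp add: kappa_mix_in_denjoy_class)
next
  assume d: "harmonic_measure \<mu> \<in> denjoy_class \<alpha>"
  \<comment> \<open>Some root always exists and represents the harmonic measure as a mixture;
    singularity of distinct classes forces it to be \<open>\<alpha>\<close>.\<close>
  obtain \<theta> where \<theta>: "0 < \<theta>" "\<theta> < 1" "denjoy_defect \<mu> \<theta> = 0"
    by (rule defect_root [OF nd supp])
  then obtain p where p: "0 < p" "p < 1" "harmonic_measure \<mu> = kappa_mix \<theta> p"
    by (rule harmonic_measure_if_defect_0 [OF nd supp])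
  have "absolutely_continuous (kappa_mix \<alpha> (1 / 2)) (kappa_mix \<theta> p)"
    using d by (simp add: denjoy_class_def equivalent_measures_def p(3))
  then have "\<alpha> = \<theta>"
    using \<alpha> \<theta> p by (intro kappa_mix_absolutely_continuous_imp_eq) auto
  with \<theta> show "denjoy_defect \<mu> \<alpha> = 0"
    by simp
qed

theorem theorem2p21:
  fixes \<mu> :: "letter list pmf" and \<alpha> wa wb wbi wb' wbi' :: real
  assumes "nondegenerate \<mu>"
    and "set_pmf \<mu> \<subseteq> {[La], [Lb], [Lbi], [Lb, La], [Lbi, La]}"
    and "pmf \<mu> [La] = wa"
    and "pmf \<mu> [Lb] = wb"
    and "pmf \<mu> [Lbi] = wbi"
    and "pmf \<mu> [Lb, La] = wb'"
    and "pmf \<mu> [Lbi, La] = wbi'"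
    and "0 < \<alpha>" and "\<alpha> < 1"
  shows "(harmonic_measure \<mu> \<in> denjoy_class \<alpha> \<longleftrightarrow>
           (\<alpha> - wbi * (1 - \<alpha>) - wb') * (wa * (1 - \<alpha>) + wb' * \<alpha> + wbi)
           = (wa * \<alpha> + wbi' * (1 - \<alpha>) + wb) * ((1 - \<alpha>) - wb * \<alpha> - wbi'))
       \<and> (harmonic_measure \<mu> \<in> minkowski_class \<longleftrightarrow>
           (1 - wbi - 2 * wb') * (wa + wb' + 2 * wbi)
           = (wa + wbi' + 2 * wb) * (1 - wb - 2 * wbi'))"
proof -
  have supp: "set_pmf \<mu> \<subseteq> steps"
    using assms(2) by (simp add: steps_def)
  have "4 * denjoy_defect \<mu> (1 / 2) =
      (1 - wbi - 2 * wb') * (wa + wb' + 2 * wbi) - (wa + wbi' + 2 * wb) * (1 - wb - 2 * wbi')"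
    by (simp add: denjoy_defect_def assms(3-7) field_simps)
  then have half: "denjoy_defect \<mu> (1 / 2) = 0 \<longleftrightarrow>
      (1 - wbi - 2 * wb') * (wa + wb' + 2 * wbi) = (wa + wbi' + 2 * wb) * (1 - wb - 2 * wbi')"
    by linarith
  have "harmonic_measure \<mu> \<in> denjoy_class \<gamma> \<longleftrightarrow> denjoy_defect \<mu> \<gamma> = 0" if "0 < \<gamma>" "\<gamma> < 1" for \<gamma>
    using harmonic_measure_in_denjoy_class_iff [OF assms(1) supp that] .
  from this [OF assms(8,9)] this [of "1 / 2"] show ?thesis
    by (simp add: minkowski_class_def half) (simp add: denjoy_defect_def assms(3-7))
qed

end
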